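(* Define the random variables $$g_{\mathrm{TD^2}}(t,s,a,s',\vec X_t,X_t^{(n)}):=(1-\gamma)\nabla_\theta v_t(\vec X_t|s,a;\theta)^\top\big(v_t(\vec X_t|s,a;\theta)-u_{t|1}(\vec X_t|s')\big)+\gamma\nabla_\theta v_t(X_t^{(n)}|s,a;\theta)^\top\big(v_t(X_t^{(n)}|s,a;\theta)-v_t^{(n)}(X_t^{(n)}|s',\pi(s'))\big),$$ $$g_{\mathrm{TD}}(t,s,a,s',\vec X_t,X_1,X_t):=(1-\gamma)\nabla_\theta v_t(\vec X_t|s,a;\theta)^\top\big(v_t(\vec X_t|s,a;\theta)-u_{t|1}(\vec X_t|s')\big)+\gamma\nabla_\theta v_t(X_t|s,a;\theta)^\top\big(v_t(X_t|s,a;\theta)-u_{t|1}(X_t|X_1)\big),$$ where $t\sim\mathcal U([0,1])$, $(s,a)\sim\rho$, $s'\sim P(\cdot|s,a)$, $\vec X_t\sim p_{t|1}(\cdot|s')$, $X_t^{(n)}\sim m_t^{(n)}(\cdot|s',\pi(s'))$, $X_1\sim m_1^{(n)}(\cdot|s',\pi(s'))$ and $X_t\sim p_{t|1}(\cdot|X_1)$. Then $g_{\mathrm{TD^2}}$ and $g_{\mathrm{TD}}$ are respectively unbiased estimates of the gradients $\nabla_\theta\ell_{\mathrm{TD^2\text{-}CFM}}(\theta)$ and $\nabla_\theta\ell_{\mathrm{TD\text{-}CFM}}(\theta)$. Moreover, consider their respective total variations $$\sigma^2_{\mathrm{TD^2\text{-}CFM}}=\mathrm{Trace}\big(\mathrm{Cov}_{t,s,a,s',\vec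 X_t,X_t^{(n)}}[g_{\mathrm{TD^2}}(t,s,a,s',\vec X_t,X_t^{(n)})]\big),$$ $$\sigma^2_{\mathrm{TD\text{-}CFM}}=\mathrm{Trace}\big(\mathrm{Cov}_{t,s,a,s',\vec X_t,X_1,X_t}[g_{\mathrm{TD}}(t,s,a,s',\vec X_t,X_1,X_t)]\big),$$ and assume that $m_t^{(n)}(x|s,a)=\int p_{t|1}(x|x_1)\,m_1^{(n)}(x_1|s,a)\,\mathrm dx_1$. Then $$\sigma^2_{\mathrm{TD\text{-}CFM}}=\sigma^2_{\mathrm{TD^2\text{-}CFM}}+\gamma^2\,\mathbb E_{t,s,a,X_t}\Big[\mathrm{Trace}\Big(\mathrm{Cov}_{X_1\mid s,a,X_t}\big[\nabla_\theta v_t(X_t|s,a;\theta)^\top u_{t|1}(X_t|X_1)\big]\Big)\Big].$$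
   Context: $\mathsf S\subseteq\mathbb R^d$ is the state space, $\mathsf A$ the action space, $P$ a transition kernel, $\pi:\mathsf S\to\mathsf A$ a deterministic policy, $\gamma\in[0,1)$, $\rho$ a distribution over $\mathsf S\times\mathsf A$. $v_t(x|s,a;\theta)\in\mathbb R^d$ is a vector field parametrized by $\theta$, with Jacobian $\nabla_\theta v_t$ in $\theta$. $m_0$ is a source law on $\mathbb R^d$. A vector field $v_t$ with flow $\frac{\mathrm d}{\mathrm dt}\psi_t(x)=v_t(\psi_t(x))$, $\psi_0(x)=x$, generates the probability path $m_t$ if $\psi_t(X_0)\sim m_t$ for $X_0\sim m_0$. For each $x_1$, $u_{t|1}(\cdot|x_1)$ is a vector field generating the conditional probability path $p_{t|1}(\cdot|x_1)$, which goes from $m_0$ at $t=0$ to $\delta_{x_1}$ at $t=1$. $v_t^{(n)}(\cdot|s,a)$ is the vector field obtained at the previous ($n$-th) iteration, held fixed (it does not depend on $\theta$), and $m_t^{(n)}(\cdot|s,a)$ is the probability path it generates; the same $v_t^{(n)}$, $m_t^{(n)}$ are used for both algorithms. Losses (random variables distributed as in the claim): $$\ell_{\mathrm{TD^2\text{-}CFM}}(\theta)=(1-\gamma)\,\mathbb E_{t,s,a,s',\vec X_t}\|v_t(\vec X_t|s,a;\theta)-u_{t|1}(\vec X_t|s')\|^2+\gamma\,\mathbb E_{t,s,a,s',X_t^{(n)}}\|v_t(X_t^{(n)}|s,a;\theta)-v_t^{(n)}(X_t^{(n)}|s',\pi(s'))\|^2,$$ $$\ell_{\mathrm{TD\text{-}CFM}}(\theta)=(1-\gamma)\,\mathbb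 E_{t,s,a,s',\vec X_t}\|v_t(\vec X_t|s,a;\theta)-u_{t|1}(\vec X_t|s')\|^2+\gamma\,\mathbb E_{t,s,a,s',X_1,X_t}\|v_t(X_t|s,a;\theta)-u_{t|1}(X_t|X_1)\|^2.$$
   Formalization: Gradients equal 2E[g] (the printed factor is off by 2); the covariance also conditions on t and s'; the variance identity also assumes v_t^(n) = E[u_{t|1}(X_t|X_1)|X_t]; differentiability in θ, finite losses, local domination and finite second moments are assumed. *)

theory Defs
  imports "HOL-Probability.Probability"
begin

section \<open>Measurable spaces\<close>

definition time_space :: "real measure" where
  "time_space = restrict_space borel {0..1}"

definition state_space :: "(real^'d) set \<Rightarrow> (real^'d) measure" where
  "state_space S = restrict_space borel S"

text \<open>Lebesgue measure on the unit interval has total mass 1, so it is the uniform law.\<close>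

definition uniform_time :: "real measure" where
  "uniform_time = restrict_space lborel {0..1}"


section \<open>Vector fields and probability paths\<close>

text \<open>
  The flow equation is required on \<open>[0,1)\<close>, with continuous trajectories on \<open>[0,1]\<close>:
  fields that steer every trajectory to a fixed point \<open>x\<^sub>1\<close> at time 1, such as
  \<open>(x\<^sub>1 - x) / (1 - t)\<close>, are singular there.
\<close>

definition generates ::
  "(real^'d) measure \<Rightarrow> (real \<Rightarrow> real^'d \<Rightarrow> real^'d) \<Rightarrow> (real \<Rightarrow> (real^'d) measure) \<Rightarrow> bool" where
  "generates m0 w m \<longleftrightarrow> (\<exists>\<psi>.
     (\<forall>x. \<psi> 0 x = x \<and> continuous_on {0..1} (\<lambda>t. \<psi> t x) \<and>
        (\<forall>t\<in>{0..<1}. ((\<lambda>r. \<psi> r x) has_vector_derivative w t (\<psi> t x)) (at t within {0..1}))) \<and>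
     (\<forall>t\<in>{0..1}. \<psi> t \<in> borel_measurable borel \<and> distr m0 borel (\<psi> t) = m t))"

text \<open>
  \<open>w\<close> is the marginal velocity, with respect to \<open>X\<^sub>1 \<sim> q\<close>, \<open>X \<sim> k X\<^sub>1\<close>, of the conditional
  velocity \<open>c X X\<^sub>1\<close>. In terms of densities this says
  \<open>w x * m x = \<integral> c x x\<^sub>1 * k x\<^sub>1 x * q x\<^sub>1 dx\<^sub>1\<close>; it is integrated over Borel sets because
  the laws need not have densities.
\<close>

definition marginal_velocity ::
  "(real^'d) measure \<Rightarrow> (real^'d \<Rightarrow> (real^'d) measure) \<Rightarrow> (real^'d \<Rightarrow> real^'d \<Rightarrow> real^'d) \<Rightarrow>
   (real^'d) measure \<Rightarrow> (real^'d \<Rightarrow> real^'d) \<Rightarrow> bool" where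
  "marginal_velocity q k c m w \<longleftrightarrow>
     (let J = do { x1 \<leftarrow> q; x \<leftarrow> k x1; return (borel \<Otimes>\<^sub>M borel) (x1, x) } in
        integrable J (\<lambda>(x1, x). c x x1) \<and> integrable m w \<and>
        (\<forall>B\<in>sets borel.
           (\<integral>x. indicator B x *\<^sub>R w x \<partial>m) = (\<integral>(x1, x). indicator B x *\<^sub>R c x x1 \<partial>J)))"


section \<open>Joint laws of the sampled variables\<close>

text \<open>
  The sample of the first law is \<open>(t, s, a, s', x, y)\<close>, where \<open>x\<close> is drawn from
  the conditional path ending at \<open>s'\<close> and \<open>y\<close> from the bootstrap path.
  In the second law, \<open>(t, s, a, s', x, x1, y)\<close>, the point \<open>y\<close> is drawn from the conditional
  path ending at the bootstrap sample \<open>x1\<close>. In both laws \<open>x\<close> is conditionally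
  independent of the bootstrap sample given \<open>(t, s, a, s')\<close>.
\<close>

definition td2_law ::
  "(real^'d) set \<Rightarrow> 'a measure \<Rightarrow> ((real^'d) \<times> 'a) measure \<Rightarrow> (real^'d \<Rightarrow> 'a \<Rightarrow> (real^'d) measure) \<Rightarrow>
   (real^'d \<Rightarrow> 'a) \<Rightarrow> (real \<Rightarrow> real^'d \<Rightarrow> (real^'d) measure) \<Rightarrow>
   (real \<Rightarrow> real^'d \<Rightarrow> 'a \<Rightarrow> (real^'d) measure) \<Rightarrow>
   (real \<times> (real^'d) \<times> 'a \<times> (real^'d) \<times> (real^'d) \<times> (real^'d)) measure" where
  "td2_law S A \<rho> P \<pi> p mn = do {
     t \<leftarrow> uniform_time;
     (s, a) \<leftarrow> \<rho>;
     s' \<leftarrow> P s a;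
     x \<leftarrow> p t s';
     y \<leftarrow> mn t s' (\<pi> s');
     return (time_space \<Otimes>\<^sub>M state_space S \<Otimes>\<^sub>M A \<Otimes>\<^sub>M state_space S \<Otimes>\<^sub>M borel \<Otimes>\<^sub>M borel)
       (t, s, a, s', x, y) }"

definition td_law ::
  "(real^'d) set \<Rightarrow> 'a measure \<Rightarrow> ((real^'d) \<times> 'a) measure \<Rightarrow> (real^'d \<Rightarrow> 'a \<Rightarrow> (real^'d) measure) \<Rightarrow>
   (real^'d \<Rightarrow> 'a) \<Rightarrow> (real \<Rightarrow> real^'d \<Rightarrow> (real^'d) measure) \<Rightarrow>
   (real \<Rightarrow> real^'d \<Rightarrow> 'a \<Rightarrow> (real^'d) measure) \<Rightarrow>
   (real \<times> (real^'d) \<times> 'a \<times> (real^'d) \<times> (real^'d) \<times> (real^'d) \<times> (real^'d)) measure" where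
  "td_law S A \<rho> P \<pi> p mn = do {
     t \<leftarrow> uniform_time;
     (s, a) \<leftarrow> \<rho>;
     s' \<leftarrow> P s a;
     x \<leftarrow> p t s';
     x1 \<leftarrow> mn 1 s' (\<pi> s');
     y \<leftarrow> p t x1;
     return (time_space \<Otimes>\<^sub>M state_space S \<Otimes>\<^sub>M A \<Otimes>\<^sub>M state_space S \<Otimes>\<^sub>M borel \<Otimes>\<^sub>M borel \<Otimes>\<^sub>M borel)
       (t, s, a, s', x, x1, y) }"


section \<open>Losses and gradient estimators\<close>

definition td2_loss where
  "td2_loss S A \<rho> P \<pi> p mn \<gamma> v u vn \<theta> =
     (1 - \<gamma>) * (\<integral>(t, s, a, s', x, y). (norm (v t x s a \<theta> - u t x s'))\<^sup>2
                   \<partial>td2_law S A \<rho> P \<pi> p mn)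
     + \<gamma> * (\<integral>(t, s, a, s', x, y). (norm (v t y s a \<theta> - vn t y s' (\<pi> s')))\<^sup>2
                   \<partial>td2_law S A \<rho> P \<pi> p mn)"

definition td_loss where
  "td_loss S A \<rho> P \<pi> p mn \<gamma> v u \<theta> =
     (1 - \<gamma>) * (\<integral>(t, s, a, s', x, x1, y). (norm (v t x s a \<theta> - u t x s'))\<^sup>2
                   \<partial>td_law S A \<rho> P \<pi> p mn)
     + \<gamma> * (\<integral>(t, s, a, s', x, x1, y). (norm (v t y s a \<theta> - u t y x1))\<^sup>2
                   \<partial>td_law S A \<rho> P \<pi> p mn)"

text \<open>The transposed parameter Jacobian of \<open>v\<close>, applied to \<open>w\<close>.\<close>

definition vjp ::
  "(real \<Rightarrow> real^'d \<Rightarrow> real^'d \<Rightarrow> 'a \<Rightarrow> real^'k \<Rightarrow> real^'d) \<Rightarrow> real^'k \<Rightarrow>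
   real \<Rightarrow> real^'d \<Rightarrow> real^'d \<Rightarrow> 'a \<Rightarrow> real^'d \<Rightarrow> real^'k" where
  "vjp v \<theta> t x s a w = transpose (jacobian (\<lambda>\<eta>. v t x s a \<eta>) (at \<theta>)) *v w"

text \<open>
  The estimators omit the factor 2 from differentiating a squared norm: their means are
  half the gradients of the losses.
\<close>

definition td2_grad where
  "td2_grad \<gamma> v u vn \<pi> \<theta> = (\<lambda>(t, s, a, s', x, y).
     (1 - \<gamma>) *\<^sub>R vjp v \<theta> t x s a (v t x s a \<theta> - u t x s')
     + \<gamma> *\<^sub>R vjp v \<theta> t y s a (v t y s a \<theta> - vn t y s' (\<pi> s')))"

definition td_grad where
  "td_grad \<gamma> v u \<theta> = (\<lambda>(t, s, a, s', x, x1, y).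
     (1 - \<gamma>) *\<^sub>R vjp v \<theta> t x s a (v t x s a \<theta> - u t x s')
     + \<gamma> *\<^sub>R vjp v \<theta> t y s a (v t y s a \<theta> - u t y x1))"

text \<open>The standard condition for differentiating under the expectation.\<close>

definition locally_dominated ::
  "'w measure \<Rightarrow> ('p::metric_space \<Rightarrow> 'w \<Rightarrow> 'b::real_normed_vector) \<Rightarrow> 'p \<Rightarrow> bool" where
  "locally_dominated M g \<theta> \<longleftrightarrow> (\<exists>\<epsilon>>0. \<exists>G::'w \<Rightarrow> real.
     integrable M G \<and> (AE \<omega> in M. \<forall>\<eta>\<in>ball \<theta> \<epsilon>. norm (g \<eta> \<omega>) \<le> G \<omega>))"


section \<open>Covariance matrices\<close>

definition cov_matrix :: "'w measure \<Rightarrow> ('w \<Rightarrow> real^'k) \<Rightarrow> real^'k^'k" where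
  "cov_matrix M Z = (\<chi> i j. \<integral>\<omega>. (Z \<omega> $ i - (\<integral>\<omega>'. Z \<omega>' $ i \<partial>M)) *
                                (Z \<omega> $ j - (\<integral>\<omega>'. Z \<omega>' $ j \<partial>M)) \<partial>M)"

definition cond_cov_matrix ::
  "'w measure \<Rightarrow> 'w measure \<Rightarrow> ('w \<Rightarrow> real^'k) \<Rightarrow> 'w \<Rightarrow> real^'k^'k" where
  "cond_cov_matrix M F Z \<omega> = (\<chi> i j.
     real_cond_exp M F (\<lambda>\<omega>'. (Z \<omega>' $ i - real_cond_exp M F (\<lambda>\<omega>''. Z \<omega>'' $ i) \<omega>') *
                             (Z \<omega>' $ j - real_cond_exp M F (\<lambda>\<omega>''. Z \<omega>'' $ j) \<omega>')) \<omega>)"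

text \<open>
  The \<open>\<sigma>\<close>-algebra generated by \<open>(t, s, a, s', y)\<close>. The next state must be included:
  \<open>x1\<close> is drawn from a law depending on \<open>s'\<close>, and without \<open>s'\<close> the conditional covariance
  of a function of \<open>x1\<close> would also contain the randomness of the transition.
\<close>

definition td_observed ::
  "(real^'d) set \<Rightarrow> 'a measure \<Rightarrow>
   (real \<times> (real^'d) \<times> 'a \<times> (real^'d) \<times> (real^'d) \<times> (real^'d) \<times> (real^'d)) measure" where
  "td_observed S A =
     vimage_algebra
       (space (time_space \<Otimes>\<^sub>M state_space S \<Otimes>\<^sub>M A \<Otimes>\<^sub>M state_space S \<Otimes>\<^sub>M borel \<Otimes>\<^sub>M borel \<Otimes>\<^sub>M borel))
       (\<lambda>(t, s, a, s', x, x1, y). (t, s, a, s', y))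
       (time_space \<Otimes>\<^sub>M state_space S \<Otimes>\<^sub>M A \<Otimes>\<^sub>M state_space S \<Otimes>\<^sub>M borel)"

end

theory Submission
  imports Defs
begin

text \<open>
  Differentiating under the expectation is dominated convergence along sequences of parameters.
  The domination controls only the combined integrand of a loss; since both of its terms are
  nonnegative, it also makes each term integrable near \<open>\<theta>\<close>.

  For the variances, write \<open>h\<close> for the transposed Jacobian applied to the conditional velocity and
  \<open>H\<close> for the one applied to the bootstrap velocity. Then \<open>g\<^sub>T\<^sub>D = g\<^sub>T\<^sub>D\<^sub>2 - \<gamma> (h - H)\<close>. By the mixture
  assumption, discarding \<open>x1\<close> turns the TD law into the TD2 law, and by the marginal velocity
  assumption \<open>H\<close> is the conditional expectation of \<open>h\<close> given everything but \<open>x1\<close>. So the residual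
  \<open>h - H\<close> is orthogonal to \<open>g\<^sub>T\<^sub>D\<^sub>2\<close>, and the variances add. As \<open>H\<close> does not depend on \<open>x\<close>, it is
  also the conditional expectation given \<open>(t, s, a, s', y)\<close>.
\<close>

section \<open>Differentiation under the expectation\<close>

text \<open>The obstacle is integrability. The marginal velocity hypothesis bounds a first moment of
  the velocities for each \<open>(t, s')\<close> separately, with nothing uniform in the pair, so
  neither velocity need be integrable under the TD law, and signed integrals cannot be taken apart
  along the kernels. Disintegration is therefore done with nonnegative integrals, which iterate
  through every \<open>bind\<close> for any measurable integrand, and the equalities on the fibres
  over \<open>(t, s, a, s', x)\<close> add up to a joint one. Signed integrals return on sets where
  the fibre moment and the Jacobian row are bounded; countably many such sets cover almost every
  sample. The Jacobian has to take part in this argument, because integrability is available for its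
  product with the velocity and not for the velocity alone. On the differentiation side,
  \<open>v\<close> is measurable at each fixed parameter, so measurability of its Jacobian has to be
  obtained from limits of difference quotients.\<close>

lemma borel_measurable_vec_nth [measurable (raw)]:
  fixes f :: "'w \<Rightarrow> real^'k::finite"
  shows "f \<in> borel_measurable M \<Longrightarrow> (\<lambda>\<omega>. f \<omega> $ i) \<in> borel_measurable M"
  by (rule borel_measurable_continuous_on[where f="\<lambda>x. x $ i"]) (auto intro!: continuous_intros)

lemma borel_measurable_vecI:
  fixes f :: "'w \<Rightarrow> real^'k::finite"
  shows "(\<And>i. (\<lambda>\<omega>. f \<omega> $ i) \<in> borel_measurable M) \<Longrightarrow> f \<in> borel_measurable M"
  by (subst borel_measurable_euclidean_space) (auto simp: Basis_vec_def inner_axis)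

text \<open>The derivative along \<open>h\<close> is the limit of the difference quotients with
  steps \<open>1 / (n + 1)\<close>, each measurable because \<open>f\<close> is measurable at every
  fixed parameter. Measurability passes to limits of sequences, hence the discrete steps.\<close>

lemma borel_measurable_directional_derivative:
  fixes f :: "'p::real_normed_vector \<Rightarrow> 'w \<Rightarrow> real"
  assumes meas [measurable]: "\<And>\<eta>. f \<eta> \<in> borel_measurable M"
    and deriv: "\<And>\<omega>. \<omega> \<in> space M \<Longrightarrow> ((\<lambda>\<eta>. f \<eta> \<omega>) has_derivative D \<omega>) (at \<theta>)"
  shows "(\<lambda>\<omega>. D \<omega> h) \<in> borel_measurable M"
proof (rule borel_measurable_LIMSEQ_real)
  let ?e = "\<lambda>n. 1 / real (Suc n)"
  show "(\<lambda>\<omega>. (f (\<theta> + ?e n *\<^sub>R h) \<omega> - f \<theta> \<omega>) / ?e n) \<in> borel_measurable M" for n by measurable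
  fix \<omega> assume \<omega>: "\<omega> \<in> space M"
  have line: "((\<lambda>r. \<theta> + r *\<^sub>R h) has_derivative (\<lambda>r. r *\<^sub>R h)) (at (0::real))"
    by (auto intro!: derivative_eq_intros)
  have "((\<lambda>r. f (\<theta> + r *\<^sub>R h) \<omega>) has_derivative (\<lambda>r. D \<omega> (r *\<^sub>R h))) (at (0::real))"
    using has_derivative_compose[OF line, of "\<lambda>\<eta>. f \<eta> \<omega>" "D \<omega>"] deriv[OF \<omega>] by simp
  then have "DERIV (\<lambda>r. f (\<theta> + r *\<^sub>R h) \<omega>) 0 :> D \<omega> h"
    by (rule has_derivative_imp_has_field_derivative)
      (simp add: linear_scale[OF has_derivative_linear[OF deriv[OF \<omega>]]])
  then have lim: "(\<lambda>r. (f (\<theta> + r *\<^sub>R h) \<omega> - f \<theta> \<omega>) / r) \<midarrow>0\<rightarrow> D \<omega> h"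
    by (simp add: DERIV_def)
  have "filterlim ?e (at 0) sequentially"
    using LIMSEQ_inverse_real_of_nat by (intro filterlim_atI) (auto simp: divide_inverse)
  from filterlim_compose[OF lim this]
  show "(\<lambda>n. (f (\<theta> + ?e n *\<^sub>R h) \<omega> - f \<theta> \<omega>) / ?e n) \<longlonglongrightarrow> D \<omega> h" .
qed

text \<open>Row \<open>i\<close> of the transpose is column \<open>i\<close> of the Jacobian, that
  is, the derivative along \<open>axis i 1\<close>, so each entry is a directional derivative of a
  component of \<open>f\<close>.\<close>

lemma borel_measurable_transpose_jacobian:
  fixes f :: "real^'k::finite \<Rightarrow> 'w \<Rightarrow> real^'d::finite"
  assumes [measurable]: "\<And>\<eta>. f \<eta> \<in> borel_measurable M"
    and diff: "\<And>\<omega>. \<omega> \<in> space M \<Longrightarrow> (\<lambda>\<eta>. f \<eta> \<omega>) differentiable (at \<theta>)"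
  shows "(\<lambda>\<omega>. transpose (jacobian (\<lambda>\<eta>. f \<eta> \<omega>) (at \<theta>)) $ i) \<in> borel_measurable M"
proof (rule borel_measurable_vecI)
  fix j
  let ?J = "\<lambda>\<omega>. jacobian (\<lambda>\<eta>. f \<eta> \<omega>) (at \<theta>)"
  have "(\<lambda>\<omega>. (?J \<omega> *v axis i 1) $ j) \<in> borel_measurable M"
  proof (rule borel_measurable_directional_derivative[where D="\<lambda>\<omega> h. (?J \<omega> *v h) $ j"])
    show "((\<lambda>\<eta>. f \<eta> \<omega> $ j) has_derivative (\<lambda>h. (?J \<omega> *v h) $ j)) (at \<theta>)" if "\<omega> \<in> space M" for \<omega>
      using diff[OF that] unfolding jacobian_works by (rule bounded_linear.has_derivative[OF bounded_linear_vec_nth])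
  qed measurable
  then show "(\<lambda>\<omega>. transpose (?J \<omega>) $ i $ j) \<in> borel_measurable M"
    by (simp add: matrix_vector_mult_basis column_def transpose_def)
qed

section \<open>Gradients of expectations and of weighted squared errors\<close>

text \<open>The mean value inequality on the convex ball turns the bound \<open>G\<close> on the
  gradients into a Lipschitz bound with random constant \<open>G\<close>. This makes
  \<open>f\<close> integrable at all nearby parameters and dominates the difference quotients.
  Measurability of \<open>g \<theta>\<close> is derived: its components are directional derivatives
  of \<open>f\<close>. The last conclusion serves to split a loss into its two terms at parameters
  other than \<theta>.\<close>

lemma gderiv_integral:
  fixes f :: "'p::euclidean_space \<Rightarrow> 'w \<Rightarrow> real"
  assumes meas [measurable]: "\<And>\<eta>. f \<eta> \<in> borel_measurable M"
    and int: "integrable M (f \<theta>)"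
    and deriv: "\<And>\<eta> \<omega>. \<omega> \<in> space M \<Longrightarrow> GDERIV (\<lambda>\<eta>. f \<eta> \<omega>) \<eta> :> g \<eta> \<omega>"
    and dom: "locally_dominated M g \<theta>"
  shows "integrable M (g \<theta>)"
    and "GDERIV (\<lambda>\<eta>. \<integral>\<omega>. f \<eta> \<omega> \<partial>M) \<theta> :> (\<integral>\<omega>. g \<theta> \<omega> \<partial>M)"
    and "\<exists>\<epsilon>>0. \<forall>\<eta>\<in>ball \<theta> \<epsilon>. integrable M (f \<eta>)"
proof -
  obtain \<epsilon> G where \<epsilon>: "\<epsilon> > 0" and G: "integrable M G"
    and gG: "AE \<omega> in M. \<forall>\<eta>\<in>ball \<theta> \<epsilon>. norm (g \<eta> \<omega>) \<le> G \<omega>"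
    using dom unfolding locally_dominated_def by blast
  \<comment> \<open>The null set is the one of \<open>gG\<close>, where the quantifier over the ball
    stands inside the \<open>AE\<close>; it thus serves all \<eta> at once.\<close>
  have lip: "AE \<omega> in M. \<forall>\<eta>\<in>ball \<theta> \<epsilon>. \<bar>f \<eta> \<omega> - f \<theta> \<omega>\<bar> \<le> G \<omega> * norm (\<eta> - \<theta>)"
    using gG
  proof (rule AE_mp, intro AE_I2 impI ballI)
    fix \<omega> \<eta> assume \<omega>: "\<omega> \<in> space M" and b: "\<forall>\<eta>\<in>ball \<theta> \<epsilon>. norm (g \<eta> \<omega>) \<le> G \<omega>"
      and \<eta>: "\<eta> \<in> ball \<theta> \<epsilon>"
    have "norm (f \<eta> \<omega> - f \<theta> \<omega>) \<le> G \<omega> * norm (\<eta> - \<theta>)"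
    proof (rule differentiable_bound[of "ball \<theta> \<epsilon>"])
      fix \<xi> assume \<xi>: "\<xi> \<in> ball \<theta> \<epsilon>"
      show "((\<lambda>\<eta>. f \<eta> \<omega>) has_derivative (\<lambda>h. inner h (g \<xi> \<omega>))) (at \<xi> within ball \<theta> \<epsilon>)"
        using deriv[OF \<omega>, of \<xi>] unfolding gderiv_def by (rule has_derivative_at_withinI)
      show "onorm (\<lambda>h. inner h (g \<xi> \<omega>)) \<le> G \<omega>"
      proof (rule onorm_le)
        fix h
        have "norm (inner h (g \<xi> \<omega>)) \<le> norm h * norm (g \<xi> \<omega>)"
          by (simp add: Cauchy_Schwarz_ineq2)
        also have "\<dots> \<le> norm h * G \<omega>"
          using b \<xi> by (intro mult_left_mono) auto
        finally show "norm (inner h (g \<xi> \<omega>)) \<le> G \<omega> * norm h" by (simp add: mult.commute)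
      qed
    qed (use \<eta> \<epsilon> in auto)
    then show "\<bar>f \<eta> \<omega> - f \<theta> \<omega>\<bar> \<le> G \<omega> * norm (\<eta> - \<theta>)" by simp
  qed
  have int_f: "integrable M (f \<eta>)" if \<eta>: "\<eta> \<in> ball \<theta> \<epsilon>" for \<eta>
  proof -
    have "integrable M (\<lambda>\<omega>. f \<eta> \<omega> - f \<theta> \<omega>)"
    proof (rule Bochner_Integration.integrable_bound)
      show "integrable M (\<lambda>\<omega>. G \<omega> * norm (\<eta> - \<theta>))" using G by simp
      show "AE \<omega> in M. norm (f \<eta> \<omega> - f \<theta> \<omega>) \<le> norm (G \<omega> * norm (\<eta> - \<theta>))"
        using lip by eventually_elim (use \<eta> in force)
    qed measurable
    from Bochner_Integration.integrable_add[OF this int] show ?thesis by simp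
  qed
  then show "\<exists>\<epsilon>>0. \<forall>\<eta>\<in>ball \<theta> \<epsilon>. integrable M (f \<eta>)" using \<epsilon> by blast
  have [measurable]: "g \<theta> \<in> borel_measurable M"
  proof (subst borel_measurable_euclidean_space, intro ballI)
    fix i :: 'p
    show "(\<lambda>\<omega>. g \<theta> \<omega> \<bullet> i) \<in> borel_measurable M"
      using borel_measurable_directional_derivative[OF meas, where D="\<lambda>\<omega> h. h \<bullet> g \<theta> \<omega>" and h=i] deriv
      unfolding gderiv_def by (simp add: inner_commute)
  qed
  show int_g: "integrable M (g \<theta>)"
  proof (rule Bochner_Integration.integrable_bound[OF G])
    show "AE \<omega> in M. norm (g \<theta> \<omega>) \<le> norm (G \<omega>)"
      using gG
    proof eventually_elim
      case (elim \<omega>)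
      then have "norm (g \<theta> \<omega>) \<le> G \<omega>" using \<epsilon> by simp
      then show ?case by simp
    qed
  qed measurable
  show "GDERIV (\<lambda>\<eta>. \<integral>\<omega>. f \<eta> \<omega> \<partial>M) \<theta> :> (\<integral>\<omega>. g \<theta> \<omega> \<partial>M)"
    unfolding gderiv_def has_derivative_at
  proof (intro conjI bounded_linear_inner_left)
    let ?F = "\<lambda>\<eta>. \<integral>\<omega>. f \<eta> \<omega> \<partial>M" and ?g = "\<integral>\<omega>. g \<theta> \<omega> \<partial>M"
    show "(\<lambda>h. norm (?F (\<theta> + h) - ?F \<theta> - h \<bullet> ?g) / norm h) \<midarrow>0\<rightarrow> 0"
      unfolding tendsto_at_iff_sequentially comp_def
    proof (intro allI impI)
      fix X :: "nat \<Rightarrow> 'p"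
      assume X0: "\<forall>n. X n \<in> UNIV - {0}" and X: "X \<longlonglongrightarrow> 0"
      then obtain N where N: "\<And>n. n \<ge> N \<Longrightarrow> norm (X n) < \<epsilon>"
        using \<epsilon> unfolding LIMSEQ_iff by (metis diff_zero)
      \<comment> \<open>From index \<open>N\<close> on the sequence stays in the ball, where
        \<open>lip\<close> and \<open>int_f\<close> apply; \<open>LIMSEQ_offset\<close> undoes the
        shift at the end.\<close>
      define Y where "Y n = X (n + N)" for n
      have Y0: "Y n \<noteq> 0" and Y\<epsilon>: "\<theta> + Y n \<in> ball \<theta> \<epsilon>" for n
        using X0 N[of "n + N"] by (auto simp: Y_def dist_norm)
      have Y: "Y \<longlonglongrightarrow> 0" unfolding Y_def using X by (rule LIMSEQ_ignore_initial_segment)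
      define q where "q n \<omega> = (f (\<theta> + Y n) \<omega> - f \<theta> \<omega> - Y n \<bullet> g \<theta> \<omega>) / norm (Y n)" for n \<omega>
      have [measurable]: "q n \<in> borel_measurable M" for n unfolding q_def by measurable
      \<comment> \<open>In the dominating function \<open>2 * G\<close>, one \<open>G\<close> bounds
        the difference quotient through \<open>lip\<close>, the other the linear term through
        Cauchy-Schwarz.\<close>
      have "(\<lambda>n. \<integral>\<omega>. q n \<omega> \<partial>M) \<longlonglongrightarrow> (\<integral>\<omega>. 0 \<partial>M)"
      proof (rule integral_dominated_convergence[where w="\<lambda>\<omega>. 2 * G \<omega>"])
        show "integrable M (\<lambda>\<omega>. 2 * G \<omega>)" using G by simp
        show "AE \<omega> in M. (\<lambda>n. q n \<omega>) \<longlonglongrightarrow> 0"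
        proof (rule AE_I2)
          fix \<omega> assume "\<omega> \<in> space M"
          then have "(\<lambda>h. norm (f (\<theta> + h) \<omega> - f \<theta> \<omega> - h \<bullet> g \<theta> \<omega>) / norm h) \<midarrow>0\<rightarrow> 0"
            using deriv[of \<omega> \<theta>] unfolding gderiv_def has_derivative_at by blast
          then have "(\<lambda>n. norm (q n \<omega>)) \<longlonglongrightarrow> 0"
            unfolding tendsto_at_iff_sequentially comp_def q_def using Y Y0 by simp
          then show "(\<lambda>n. q n \<omega>) \<longlonglongrightarrow> 0" by (rule tendsto_norm_zero_cancel)
        qed
        show "AE \<omega> in M. norm (q n \<omega>) \<le> 2 * G \<omega>" for n
          using lip gG
        proof eventually_elim
          case (elim \<omega>)
          have "\<bar>f (\<theta> + Y n) \<omega> - f \<theta> \<omega>\<bar> \<le> G \<omega> * norm (Y n)" using elim(1) Y\<epsilon>[of n] by force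
          moreover have "\<bar>Y n \<bullet> g \<theta> \<omega>\<bar> \<le> norm (Y n) * norm (g \<theta> \<omega>)"
            by (rule Cauchy_Schwarz_ineq2)
          moreover have "norm (Y n) * norm (g \<theta> \<omega>) \<le> norm (Y n) * G \<omega>"
            using elim(2) \<epsilon> by (intro mult_left_mono) auto
          ultimately have "\<bar>f (\<theta> + Y n) \<omega> - f \<theta> \<omega> - Y n \<bullet> g \<theta> \<omega>\<bar> \<le> G \<omega> * norm (Y n) + norm (Y n) * G \<omega>"
            by linarith
          then have "\<bar>f (\<theta> + Y n) \<omega> - f \<theta> \<omega> - Y n \<bullet> g \<theta> \<omega>\<bar> \<le> 2 * G \<omega> * norm (Y n)"
            by (simp add: algebra_simps)
          then show ?case unfolding q_def using Y0[of n] by (simp add: pos_divide_le_eq)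
        qed
      qed measurable
      moreover have "(\<integral>\<omega>. q n \<omega> \<partial>M) = (?F (\<theta> + Y n) - ?F \<theta> - Y n \<bullet> ?g) / norm (Y n)" for n
        unfolding q_def using int_f[OF Y\<epsilon>[of n]] int int_g by simp
      ultimately have "(\<lambda>n. (?F (\<theta> + Y n) - ?F \<theta> - Y n \<bullet> ?g) / norm (Y n)) \<longlonglongrightarrow> 0"
        by simp
      from tendsto_norm_zero[OF this]
      have "(\<lambda>n. norm (?F (\<theta> + Y n) - ?F \<theta> - Y n \<bullet> ?g) / norm (Y n)) \<longlonglongrightarrow> 0" by simp
      then show "(\<lambda>n. norm (?F (\<theta> + X n) - ?F \<theta> - X n \<bullet> ?g) / norm (X n)) \<longlonglongrightarrow> 0"
        unfolding Y_def by (rule LIMSEQ_offset)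
    qed
  qed
qed

text \<open>The product rule for the inner square gives two equal terms, the source of the factor 2;
  moving the Jacobian across the inner product produces its transpose.\<close>

lemma gderiv_norm_power2:
  fixes f :: "real^'k::finite \<Rightarrow> real^'d::finite"
  assumes "f differentiable (at \<eta>)"
  shows "GDERIV (\<lambda>\<eta>. (norm (f \<eta> - c))\<^sup>2) \<eta> :>
    (2 *\<^sub>R (transpose (jacobian f (at \<eta>)) *v (f \<eta> - c)))"
proof -
  have "(f has_derivative (\<lambda>h. jacobian f (at \<eta>) *v h)) (at \<eta>)"
    using assms by (simp add: jacobian_works)
  then have "((\<lambda>\<eta>. (f \<eta> - c) \<bullet> (f \<eta> - c)) has_derivative
      (\<lambda>h. (f \<eta> - c) \<bullet> (jacobian f (at \<eta>) *v h) + (jacobian f (at \<eta>) *v h) \<bullet> (f \<eta> - c))) (at \<eta>)"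
    by (auto intro!: derivative_eq_intros)
  moreover have "(f \<eta> - c) \<bullet> (jacobian f (at \<eta>) *v h) + (jacobian f (at \<eta>) *v h) \<bullet> (f \<eta> - c)
      = h \<bullet> (2 *\<^sub>R (transpose (jacobian f (at \<eta>)) *v (f \<eta> - c)))" for h
  proof -
    have "h \<bullet> (transpose (jacobian f (at \<eta>)) *v (f \<eta> - c)) = (f \<eta> - c) \<bullet> (jacobian f (at \<eta>) *v h)"
      by (metis dot_lmul_matrix inner_commute transpose_matrix_vector)
    then show ?thesis by (simp add: inner_commute)
  qed
  ultimately show ?thesis by (simp add: gderiv_def power2_norm_eq_inner)
qed

text \<open>The integrand \<open>?f\<close> is halved so that its gradient is \<open>g\<close>
  itself, the function for which domination is assumed; the half cancels the factor 2 in the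
  gradients of the two terms.\<close>

lemma gderiv_mixture_loss:
  fixes f\<^sub>1 f\<^sub>2 :: "'p::euclidean_space \<Rightarrow> 'w \<Rightarrow> real"
  assumes \<gamma>: "0 \<le> \<gamma>" "\<gamma> < 1"
    and meas [measurable]: "\<And>\<eta>. f\<^sub>1 \<eta> \<in> borel_measurable M" "\<And>\<eta>. f\<^sub>2 \<eta> \<in> borel_measurable M"
    and nonneg: "\<And>\<eta> \<omega>. 0 \<le> f\<^sub>1 \<eta> \<omega>" "\<And>\<eta> \<omega>. 0 \<le> f\<^sub>2 \<eta> \<omega>"
    and int: "integrable M (f\<^sub>1 \<theta>)" "integrable M (f\<^sub>2 \<theta>)"
    and deriv: "\<And>\<eta> \<omega>. \<omega> \<in> space M \<Longrightarrow> GDERIV (\<lambda>\<eta>. f\<^sub>1 \<eta> \<omega>) \<eta> :> (2 *\<^sub>R g\<^sub>1 \<eta> \<omega>)"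
      "\<And>\<eta> \<omega>. \<omega> \<in> space M \<Longrightarrow> GDERIV (\<lambda>\<eta>. f\<^sub>2 \<eta> \<omega>) \<eta> :> (2 *\<^sub>R g\<^sub>2 \<eta> \<omega>)"
    and dom: "locally_dominated M g \<theta>"
    and g: "\<And>\<eta> \<omega>. \<omega> \<in> space M \<Longrightarrow> g \<eta> \<omega> = (1 - \<gamma>) *\<^sub>R g\<^sub>1 \<eta> \<omega> + \<gamma> *\<^sub>R g\<^sub>2 \<eta> \<omega>"
  shows "integrable M (g \<theta>)"
    and "GDERIV (\<lambda>\<eta>. (1 - \<gamma>) * (\<integral>\<omega>. f\<^sub>1 \<eta> \<omega> \<partial>M) + \<gamma> * (\<integral>\<omega>. f\<^sub>2 \<eta> \<omega> \<partial>M)) \<theta> :>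
      (2 *\<^sub>R (\<integral>\<omega>. g \<theta> \<omega> \<partial>M))"
proof -
  let ?f = "\<lambda>\<eta> \<omega>. ((1 - \<gamma>) * f\<^sub>1 \<eta> \<omega> + \<gamma> * f\<^sub>2 \<eta> \<omega>) / 2"
  have meas_f: "?f \<eta> \<in> borel_measurable M" for \<eta> by measurable
  have int_f: "integrable M (?f \<theta>)" using int by simp
  have deriv_f: "GDERIV (\<lambda>\<eta>. ?f \<eta> \<omega>) \<eta> :> g \<eta> \<omega>" if "\<omega> \<in> space M" for \<eta> \<omega>
  proof -
    have "((\<lambda>\<eta>. ?f \<eta> \<omega>) has_derivative (\<lambda>h. ((1 - \<gamma>) * (h \<bullet> (2 *\<^sub>R g\<^sub>1 \<eta> \<omega>)) + \<gamma> * (h \<bullet> (2 *\<^sub>R g\<^sub>2 \<eta> \<omega>))) / 2)) (at \<eta>)"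
      using deriv[OF that, of \<eta>] unfolding gderiv_def by (auto intro!: derivative_eq_intros)
    then show ?thesis by (simp add: gderiv_def g[OF that] inner_add_right add_divide_distrib)
  qed
  note * = gderiv_integral[of ?f M \<theta> g, OF meas_f int_f deriv_f dom]
  show "integrable M (g \<theta>)" by (rule *(1))
  obtain \<epsilon> where \<epsilon>: "\<epsilon> > 0" and int_ball: "\<And>\<eta>. \<eta> \<in> ball \<theta> \<epsilon> \<Longrightarrow> integrable M (?f \<eta>)"
    using *(3) by blast
  have split: "(1 - \<gamma>) * (\<integral>\<omega>. f\<^sub>1 \<eta> \<omega> \<partial>M) + \<gamma> * (\<integral>\<omega>. f\<^sub>2 \<eta> \<omega> \<partial>M) = 2 * (\<integral>\<omega>. ?f \<eta> \<omega> \<partial>M)"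
    if "\<eta> \<in> ball \<theta> \<epsilon>" for \<eta>
  proof -
    have i: "integrable M (\<lambda>\<omega>. 2 * ?f \<eta> \<omega>)" using int_ball[OF that] by (rule integrable_mult_right)
    \<comment> \<open>The weights stay inside. For \<gamma> = 0 nothing makes
      \<open>f\<^sub>2 \<eta>\<close> integrable away from \<theta>, but
      \<open>\<gamma> * f\<^sub>2 \<eta>\<close> is dominated by \<open>2 * ?f \<eta>\<close>, and a
      constant factor leaves the Bochner integral even when the function is not integrable.\<close>
    have "integrable M (\<lambda>\<omega>. (1 - \<gamma>) * f\<^sub>1 \<eta> \<omega>)" "integrable M (\<lambda>\<omega>. \<gamma> * f\<^sub>2 \<eta> \<omega>)"
      by (rule Bochner_Integration.integrable_bound[OF i]; use \<gamma> nonneg in \<open>simp add: abs_mult\<close>)+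
    from Bochner_Integration.integral_add[OF this] show ?thesis by simp
  qed
  have "GDERIV (\<lambda>\<eta>. 2 * (\<integral>\<omega>. ?f \<eta> \<omega> \<partial>M)) \<theta> :> (2 *\<^sub>R (\<integral>\<omega>. g \<theta> \<omega> \<partial>M))"
    using has_derivative_mult_right[OF *(2)[unfolded gderiv_def], of 2] by (simp add: gderiv_def)
  \<comment> \<open>The two sides of \<open>split\<close> are known to agree on a ball around
    \<theta>, which is enough for a derivative at its centre.\<close>
  then show "GDERIV (\<lambda>\<eta>. (1 - \<gamma>) * (\<integral>\<omega>. f\<^sub>1 \<eta> \<omega> \<partial>M) + \<gamma> * (\<integral>\<omega>. f\<^sub>2 \<eta> \<omega> \<partial>M)) \<theta> :>
      (2 *\<^sub>R (\<integral>\<omega>. g \<theta> \<omega> \<partial>M))"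
    unfolding gderiv_def
    by (rule has_derivative_transform_within_open[OF _ open_ball[of \<theta> \<epsilon>]]) (use \<epsilon> split in auto)
qed

section \<open>Conditional expectations\<close>

text \<open>As \<open>ennreal\<close> sends negative reals to 0, \<open>ennreal (a \<omega>)\<close>
  and \<open>ennreal (- a \<omega>)\<close> are the positive and negative parts of \<open>a\<close>.
  The right-hand side is the equality of integrals after each negative part has changed sides, so no
  infinite values are subtracted.\<close>

lemma integral_eq_iff_nn_integral_eq:
  fixes a b :: "'w \<Rightarrow> real"
  assumes a: "integrable M a" and b: "integrable M b"
  shows "(\<integral>\<omega>. a \<omega> \<partial>M) = (\<integral>\<omega>. b \<omega> \<partial>M) \<longleftrightarrow>
    (\<integral>\<^sup>+\<omega>. ennreal (a \<omega>) + ennreal (- b \<omega>) \<partial>M) = (\<integral>\<^sup>+\<omega>. ennreal (- a \<omega>) + ennreal (b \<omega>) \<partial>M)"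
proof -
  have eq: "(\<integral>\<^sup>+\<omega>. ennreal (c \<omega>) + ennreal (d \<omega>) \<partial>M) = ennreal (\<integral>\<omega>. max (c \<omega>) 0 + max (d \<omega>) 0 \<partial>M)"
    if "integrable M c" "integrable M d" for c d :: "'w \<Rightarrow> real"
  proof -
    have "integrable M (\<lambda>\<omega>. max (c \<omega>) 0 + max (d \<omega>) 0)" using that by auto
    then have "ennreal (\<integral>\<omega>. max (c \<omega>) 0 + max (d \<omega>) 0 \<partial>M) = (\<integral>\<^sup>+\<omega>. ennreal (max (c \<omega>) 0 + max (d \<omega>) 0) \<partial>M)"
      by (subst nn_integral_eq_integral) auto
    then show ?thesis by (auto intro!: nn_integral_cong simp: max_def ennreal_neg)
  qed
  have parts: "(\<integral>\<omega>. c \<omega> \<partial>M) = (\<integral>\<omega>. max (c \<omega>) 0 \<partial>M) - (\<integral>\<omega>. max (- c \<omega>) 0 \<partial>M)"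
    if "integrable M c" for c :: "'w \<Rightarrow> real"
  proof -
    have "(\<integral>\<omega>. max (c \<omega>) 0 \<partial>M) - (\<integral>\<omega>. max (- c \<omega>) 0 \<partial>M) = (\<integral>\<omega>. max (c \<omega>) 0 - max (- c \<omega>) 0 \<partial>M)"
      using that by (subst Bochner_Integration.integral_diff) auto
    also have "\<dots> = (\<integral>\<omega>. c \<omega> \<partial>M)" by (intro Bochner_Integration.integral_cong) auto
    finally show ?thesis by simp
  qed
  have "(\<integral>\<^sup>+\<omega>. ennreal (a \<omega>) + ennreal (- b \<omega>) \<partial>M) = (\<integral>\<^sup>+\<omega>. ennreal (- a \<omega>) + ennreal (b \<omega>) \<partial>M)
    \<longleftrightarrow> (\<integral>\<omega>. max (a \<omega>) 0 + max (- b \<omega>) 0 \<partial>M) = (\<integral>\<omega>. max (- a \<omega>) 0 + max (b \<omega>) 0 \<partial>M)"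
    using eq[of a "\<lambda>\<omega>. - b \<omega>"] eq[of "\<lambda>\<omega>. - a \<omega>" b] a b
    by (simp add: integral_nonneg_AE del: Bochner_Integration.integral_add)
  also have "\<dots> \<longleftrightarrow> (\<integral>\<omega>. a \<omega> \<partial>M) = (\<integral>\<omega>. b \<omega> \<partial>M)"
    using a b parts[OF a] parts[OF b] by auto
  finally show ?thesis by simp
qed

lemma subalgebra_vimage_algebra:
  "\<phi> \<in> M \<rightarrow>\<^sub>M N \<Longrightarrow> subalgebra M (vimage_algebra (space M) \<phi> N)"
  by (auto simp: subalgebra_def sets_vimage_algebra2 measurable_space)

text \<open>
  The products \<open>(L \<bullet> e) * (U \<bullet> e)\<close> need not be integrable, nor need \<open>U\<close> itself; the proof truncates
  to sets where \<open>L\<close> and \<open>\<beta>\<close>, which stands for a conditional first moment of \<open>U\<close> and \<open>V\<close>, are bounded.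
  The hypothesis \<open>balance\<close> says \<open>E[U \<bullet> e; B] = E[V \<bullet> e; B]\<close>, with the negative parts moved across so that
  it makes sense in \<open>ennreal\<close> without integrability.
\<close>

lemma real_cond_exp_inner:
  fixes U :: "'w \<Rightarrow> 'e::euclidean_space" and V L :: "'z \<Rightarrow> 'e"
  assumes "prob_space M"
    and \<phi> [measurable]: "\<phi> \<in> M \<rightarrow>\<^sub>M N"
    and U [measurable]: "U \<in> borel_measurable M"
    and V [measurable]: "V \<in> borel_measurable N"
    and L [measurable]: "L \<in> borel_measurable N"
    and \<beta> [measurable]: "\<beta> \<in> borel_measurable N"
    and \<beta>_fin: "AE \<omega> in M. \<beta> (\<phi> \<omega>) < (\<infinity>::ennreal)"
    and fin: "\<And>n::nat. (\<integral>\<^sup>+\<omega>. indicator {z \<in> space N. \<beta> z \<le> of_nat n} (\<phi> \<omega>) *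
        (ennreal (norm (U \<omega>)) + ennreal (norm (V (\<phi> \<omega>)))) \<partial>M) < \<infinity>"
    and balance: "\<And>B e. B \<in> sets N \<Longrightarrow> e \<in> Basis \<Longrightarrow>
       (\<integral>\<^sup>+\<omega>. indicator B (\<phi> \<omega>) * (ennreal (U \<omega> \<bullet> e) + ennreal (- (V (\<phi> \<omega>) \<bullet> e))) \<partial>M) =
       (\<integral>\<^sup>+\<omega>. indicator B (\<phi> \<omega>) * (ennreal (- (U \<omega> \<bullet> e)) + ennreal (V (\<phi> \<omega>) \<bullet> e)) \<partial>M)"
    and int: "integrable M (\<lambda>\<omega>. L (\<phi> \<omega>) \<bullet> U \<omega>)"
  shows "AE \<omega> in M. real_cond_exp M (vimage_algebra (space M) \<phi> N) (\<lambda>\<omega>. L (\<phi> \<omega>) \<bullet> U \<omega>) \<omega>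
    = L (\<phi> \<omega>) \<bullet> V (\<phi> \<omega>)"
proof -
  interpret prob_space M by fact
  let ?F = "vimage_algebra (space M) \<phi> N"
  interpret finite_measure_subalgebra M ?F
    by unfold_locales (rule subalgebra_vimage_algebra[OF \<phi>])
  have \<phi>F [measurable]: "\<phi> \<in> ?F \<rightarrow>\<^sub>M N"
    by (rule measurable_vimage_algebra1) (use measurable_space[OF \<phi>] in auto)
  have "AE \<omega> in M. \<beta> (\<phi> \<omega>) \<le> of_nat n \<and> norm (L (\<phi> \<omega>)) \<le> real n \<longrightarrow>
      real_cond_exp M ?F (\<lambda>\<omega>. L (\<phi> \<omega>) \<bullet> U \<omega>) \<omega> = L (\<phi> \<omega>) \<bullet> V (\<phi> \<omega>)" for n
  proof -
    \<comment> \<open>The indicator of \<open>D\<close> at \<open>\<phi> \<omega>\<close> is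
      measurable for the generated \<sigma>-algebra and can be pulled out of conditional
      expectations. On \<open>D\<close> the first moments are finite by \<open>fin\<close> and
      \<open>L\<close> is bounded by \<open>n\<close>.\<close>
    define D where "D = {z \<in> space N. \<beta> z \<le> of_nat n \<and> norm (L z) \<le> real n}"
    have D [measurable]: "D \<in> sets N" unfolding D_def by measurable
    let ?D = "\<lambda>\<omega>. indicat_real D (\<phi> \<omega>)"
    have bnd: "(\<integral>\<^sup>+\<omega>. indicator D (\<phi> \<omega>) * (ennreal (norm (U \<omega>)) + ennreal (norm (V (\<phi> \<omega>)))) \<partial>M) < \<infinity>"
      by (rule le_less_trans[OF nn_integral_mono fin[of n]])
        (auto simp: D_def indicator_def intro!: mult_right_mono)
    have intU: "integrable M (\<lambda>\<omega>. ?D \<omega> * (U \<omega> \<bullet> e))" and intV: "integrable M (\<lambda>\<omega>. ?D \<omega> * (V (\<phi> \<omega>) \<bullet> e))"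
      if e: "e \<in> Basis" for e
      using e by (auto intro!: integrableI_bounded le_less_trans[OF nn_integral_mono bnd]
          simp: indicator_def Basis_le_norm add_increasing add_increasing2 ennreal_leI)
    \<comment> \<open>A set of the generated \<sigma>-algebra is the preimage of some
      \<open>B\<close> under \<open>\<phi>\<close>; testing on it amounts to \<open>balance\<close>
      for \<open>B \<inter> D\<close>.\<close>
    have ce: "AE \<omega> in M. real_cond_exp M ?F (\<lambda>\<omega>. ?D \<omega> * (U \<omega> \<bullet> e)) \<omega> = ?D \<omega> * (V (\<phi> \<omega>) \<bullet> e)"
      if e: "e \<in> Basis" for e
    proof (rule real_cond_exp_charact)
      fix A assume "A \<in> sets ?F"
      then obtain B where B [measurable]: "B \<in> sets N" and A: "A = \<phi> -` B \<inter> space M"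
        by (auto simp: sets_vimage_algebra2 \<phi>[THEN measurable_space] Pi_iff)
      let ?a = "\<lambda>\<omega>. indicator (B \<inter> D) (\<phi> \<omega>) * (U \<omega> \<bullet> e)" and ?b = "\<lambda>\<omega>. indicator (B \<inter> D) (\<phi> \<omega>) * (V (\<phi> \<omega>) \<bullet> e)"
      have ia: "integrable M ?a" and ib: "integrable M ?b"
        by (rule Bochner_Integration.integrable_bound[OF intU[OF e]] Bochner_Integration.integrable_bound[OF intV[OF e]];
          auto simp: indicator_def)+
      have p: "ennreal (indicator (B \<inter> D) z * x) = indicator (B \<inter> D) z * ennreal x"
        "ennreal (- (indicator (B \<inter> D) z * x)) = indicator (B \<inter> D) z * ennreal (- x)" for x z
        by (auto simp: indicator_def)
      have "(\<integral>\<omega>. ?a \<omega> \<partial>M) = (\<integral>\<omega>. ?b \<omega> \<partial>M)"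
        unfolding integral_eq_iff_nn_integral_eq[OF ia ib] p
        using balance[of "B \<inter> D" e] e by (simp add: distrib_left)
      moreover have "set_lebesgue_integral M A (\<lambda>\<omega>. ?D \<omega> * (U \<omega> \<bullet> e)) = (\<integral>\<omega>. ?a \<omega> \<partial>M)"
        "set_lebesgue_integral M A (\<lambda>\<omega>. ?D \<omega> * (V (\<phi> \<omega>) \<bullet> e)) = (\<integral>\<omega>. ?b \<omega> \<partial>M)"
        unfolding set_lebesgue_integral_def A
        by (auto intro!: Bochner_Integration.integral_cong simp: indicator_def)
      ultimately show "set_lebesgue_integral M A (\<lambda>\<omega>. ?D \<omega> * (U \<omega> \<bullet> e)) =
          set_lebesgue_integral M A (\<lambda>\<omega>. ?D \<omega> * (V (\<phi> \<omega>) \<bullet> e))" by simp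
    qed (use intU intV e in auto)
    \<comment> \<open>The idempotent indicator is put into both factors: the first becomes bounded
      by \<open>n\<close> and the second integrable, so the product is integrable and the first
      factor can be pulled out.\<close>
    let ?l = "\<lambda>e \<omega>. ?D \<omega> * (L (\<phi> \<omega>) \<bullet> e)"
    have int_l: "integrable M (\<lambda>\<omega>. ?l e \<omega> * (?D \<omega> * (U \<omega> \<bullet> e)))" if e: "e \<in> Basis" for e
    proof (rule Bochner_Integration.integrable_bound)
      show "integrable M (\<lambda>\<omega>. real n * (?D \<omega> * (U \<omega> \<bullet> e)))" using intU[OF e] by simp
      have "\<bar>?l e \<omega>\<bar> \<le> real n" for \<omega>
        using Basis_le_norm[OF e, of "L (\<phi> \<omega>)"] by (auto simp: D_def indicator_def)
      then show "AE \<omega> in M. norm (?l e \<omega> * (?D \<omega> * (U \<omega> \<bullet> e))) \<le> norm (real n * (?D \<omega> * (U \<omega> \<bullet> e)))"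
        by (intro AE_I2) (simp add: abs_mult[of "?l e _"] abs_mult[of "real n"] mult_right_mono)
    qed measurable
    have "AE \<omega> in M. real_cond_exp M ?F (\<lambda>\<omega>. ?l e \<omega> * (?D \<omega> * (U \<omega> \<bullet> e))) \<omega>
        = ?l e \<omega> * (?D \<omega> * (V (\<phi> \<omega>) \<bullet> e))" if e: "e \<in> Basis" for e
      using real_cond_exp_mult[OF _ _ int_l[OF e]] ce[OF e] by (auto elim!: AE_mp)
    then have "AE \<omega> in M. \<forall>e\<in>Basis. real_cond_exp M ?F (\<lambda>\<omega>. ?l e \<omega> * (?D \<omega> * (U \<omega> \<bullet> e))) \<omega>
        = ?l e \<omega> * (?D \<omega> * (V (\<phi> \<omega>) \<bullet> e))"
      by (intro AE_finite_allI) auto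
    moreover have "AE \<omega> in M. real_cond_exp M ?F (\<lambda>\<omega>. \<Sum>e\<in>Basis. ?l e \<omega> * (?D \<omega> * (U \<omega> \<bullet> e))) \<omega>
        = (\<Sum>e\<in>Basis. real_cond_exp M ?F (\<lambda>\<omega>. ?l e \<omega> * (?D \<omega> * (U \<omega> \<bullet> e))) \<omega>)"
    proof -
      \<comment> \<open>The sum rule for conditional expectations asks for integrability at every
        index; padding with 0 outside \<open>Basis\<close> provides it.\<close>
      let ?h = "\<lambda>e. if e \<in> Basis then \<lambda>\<omega>. ?l e \<omega> * (?D \<omega> * (U \<omega> \<bullet> e)) else (\<lambda>\<omega>. 0)"
      have "AE \<omega> in M. real_cond_exp M ?F (\<lambda>\<omega>. \<Sum>e\<in>Basis. ?h e \<omega>) \<omega> = (\<Sum>e\<in>Basis. real_cond_exp M ?F (?h e) \<omega>)"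
        by (rule real_cond_exp_sum) (auto simp: int_l)
      moreover have "(\<Sum>e\<in>Basis. ?h e \<omega>) = (\<Sum>e\<in>Basis. ?l e \<omega> * (?D \<omega> * (U \<omega> \<bullet> e)))" for \<omega>
        by (rule sum.cong) auto
      moreover have "(\<Sum>e\<in>Basis. real_cond_exp M ?F (?h e) \<omega>) =
          (\<Sum>e\<in>Basis. real_cond_exp M ?F (\<lambda>\<omega>. ?l e \<omega> * (?D \<omega> * (U \<omega> \<bullet> e))) \<omega>)" for \<omega>
        by (rule sum.cong) auto
      ultimately show ?thesis by (simp only:)
    qed
    moreover have "(\<Sum>e\<in>Basis. ?l e \<omega> * (?D \<omega> * (x \<bullet> e))) = ?D \<omega> * (L (\<phi> \<omega>) \<bullet> x)" for \<omega> and x :: 'e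
      by (simp add: indicator_def flip: euclidean_inner)
    \<comment> \<open>The same conditional expectation evaluated without coordinates, from
      integrability of the whole inner product; comparison with the coordinate sum gives the claim
      on \<open>D\<close>.\<close>
    moreover have "AE \<omega> in M. real_cond_exp M ?F (\<lambda>\<omega>. ?D \<omega> * (L (\<phi> \<omega>) \<bullet> U \<omega>)) \<omega>
        = ?D \<omega> * real_cond_exp M ?F (\<lambda>\<omega>. L (\<phi> \<omega>) \<bullet> U \<omega>) \<omega>"
      by (rule real_cond_exp_mult) (auto intro!: Bochner_Integration.integrable_bound[OF int] simp: indicator_def)
    ultimately have "AE \<omega> in M. ?D \<omega> * real_cond_exp M ?F (\<lambda>\<omega>. L (\<phi> \<omega>) \<bullet> U \<omega>) \<omega> =
        ?D \<omega> * (L (\<phi> \<omega>) \<bullet> V (\<phi> \<omega>))"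
      by (auto elim!: AE_mp)
    with AE_space show ?thesis
      by eventually_elim (use \<phi>[THEN measurable_space] in \<open>auto simp: D_def indicator_def split: if_splits\<close>)
  qed
  \<comment> \<open>As \<beta> is finite almost everywhere, the conditions for varying
    \<open>n\<close> cover almost every sample, and there are only countably many null sets to
    discard.\<close>
  then have "AE \<omega> in M. \<forall>n. \<beta> (\<phi> \<omega>) \<le> of_nat n \<and> norm (L (\<phi> \<omega>)) \<le> real n \<longrightarrow>
      real_cond_exp M ?F (\<lambda>\<omega>. L (\<phi> \<omega>) \<bullet> U \<omega>) \<omega> = L (\<phi> \<omega>) \<bullet> V (\<phi> \<omega>)"
    unfolding AE_all_countable by blast
  with \<beta>_fin show ?thesis
  proof eventually_elim
    case (elim \<omega>)
    obtain m :: nat where m: "\<beta> (\<phi> \<omega>) \<le> of_nat m"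
      using elim(1) ennreal_Ex_less_of_nat[of "\<beta> (\<phi> \<omega>)"] by (auto intro: less_imp_le)
    obtain k :: nat where k: "norm (L (\<phi> \<omega>)) \<le> real k" using real_arch_simple by blast
    have "\<beta> (\<phi> \<omega>) \<le> of_nat (max m k)"
      using m by (rule order_trans) (simp add: of_nat_mono)
    moreover have "norm (L (\<phi> \<omega>)) \<le> real (max m k)" using k by simp
    ultimately show ?case using elim(2) by blast
  qed
qed

section \<open>Integration along kernels, and the marginal velocity on a single fibre\<close>

lemma nn_integral_bind_prob:
  assumes "M \<in> space (prob_algebra L)" "K \<in> L \<rightarrow>\<^sub>M prob_algebra N" "f \<in> borel_measurable N"
  shows "(\<integral>\<^sup>+z. f z \<partial>(M \<bind> K)) = (\<integral>\<^sup>+x. \<integral>\<^sup>+z. f z \<partial>K x \<partial>M)"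
proof (rule nn_integral_bind[OF assms(3)])
  have "sets M = sets L" using assms(1) by (simp add: space_prob_algebra)
  then show "K \<in> M \<rightarrow>\<^sub>M subprob_algebra N"
    using measurable_prob_algebraD[OF assms(2)] by (simp cong: measurable_cong_sets)
qed

lemma space_bind_prob_algebra:
  assumes "M \<in> space (prob_algebra L)" "K \<in> L \<rightarrow>\<^sub>M prob_algebra N"
  shows "M \<bind> K \<in> space (prob_algebra N)"
  using measurable_bind_prob_space[OF measurable_const[OF assms(1)] assms(2)]
  by (rule measurable_space[of _ "count_space UNIV"]) simp

text \<open>The law \<open>m\<close> is the second marginal of the joint law \<open>J\<close> of end
  point and position, so both velocities can be integrated under \<open>J\<close> and the defining
  identity of the marginal velocity becomes an identity there. It is then written with nonnegative
  integrals along \<open>q\<close> and \<open>k\<close>, the form that occurs inside the law of the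
  whole sample.\<close>

lemma marginal_velocity_balance:
  fixes c :: "real^'d::finite \<Rightarrow> real^'d \<Rightarrow> real^'d"
  assumes mv: "marginal_velocity q k c m w"
    and q: "q \<in> space (prob_algebra borel)"
    and k [measurable]: "k \<in> borel \<rightarrow>\<^sub>M prob_algebra borel"
    and m: "m = q \<bind> k"
  shows "(\<integral>\<^sup>+x1. \<integral>\<^sup>+x. ennreal (norm (c x x1)) + ennreal (norm (w x)) \<partial>k x1 \<partial>q) < \<infinity>" (is ?fin)
    and "B \<in> sets borel \<Longrightarrow>
      (\<integral>\<^sup>+x1. \<integral>\<^sup>+x. indicator B x * (ennreal (c x x1 \<bullet> e) + ennreal (- (w x \<bullet> e))) \<partial>k x1 \<partial>q) =
      (\<integral>\<^sup>+x1. \<integral>\<^sup>+x. indicator B x * (ennreal (- (c x x1 \<bullet> e)) + ennreal (w x \<bullet> e)) \<partial>k x1 \<partial>q)"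
proof -
  define J where "J = do { x1 \<leftarrow> q; x \<leftarrow> k x1; return (borel \<Otimes>\<^sub>M borel) (x1, x) }"
  have kJ: "(\<lambda>x1. k x1 \<bind> (\<lambda>x. return (borel \<Otimes>\<^sub>M borel) (x1, x))) \<in> borel \<rightarrow>\<^sub>M prob_algebra (borel \<Otimes>\<^sub>M borel)"
    by measurable
  have k_in: "k x1 \<in> space (prob_algebra borel)" for x1
    using measurable_space[OF k] by simp
  have "J \<in> space (prob_algebra (borel \<Otimes>\<^sub>M borel))"
    unfolding J_def by (rule space_bind_prob_algebra[OF q kJ])
  then have sJ [measurable_cong]: "sets J = sets (borel \<Otimes>\<^sub>M borel)" by (simp add: space_prob_algebra)
  have m_in: "m \<in> space (prob_algebra borel)" unfolding m by (rule space_bind_prob_algebra[OF q k])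
  then have sm [measurable_cong]: "sets m = sets borel" by (simp add: space_prob_algebra)
  have nnJ: "(\<integral>\<^sup>+z. g z \<partial>J) = (\<integral>\<^sup>+x1. \<integral>\<^sup>+x. g (x1, x) \<partial>k x1 \<partial>q)"
    if g [measurable]: "g \<in> borel_measurable (borel \<Otimes>\<^sub>M borel)" for g :: "(real^'d) \<times> (real^'d) \<Rightarrow> ennreal"
    unfolding J_def
  proof (subst nn_integral_bind_prob[OF q kJ g], rule nn_integral_cong)
    fix x1
    show "(\<integral>\<^sup>+z. g z \<partial>(k x1 \<bind> (\<lambda>x. return (borel \<Otimes>\<^sub>M borel) (x1, x)))) = (\<integral>\<^sup>+x. g (x1, x) \<partial>k x1)"
      by (subst nn_integral_bind_prob[OF k_in _ g])
        (measurable, auto intro!: nn_integral_cong simp: nn_integral_return space_pair_measure)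
  qed
  have dm: "distr J borel snd = m"
  proof (rule measure_eqI)
    fix B assume "B \<in> sets (distr J borel snd)"
    then have B [measurable]: "B \<in> sets borel" by simp
    have "emeasure (distr J borel snd) B = (\<integral>\<^sup>+z. indicator B (snd z) \<partial>J)"
      by (simp add: nn_integral_distr flip: nn_integral_indicator)
    also have "\<dots> = (\<integral>\<^sup>+x. indicator B x \<partial>m)"
      unfolding m by (subst nnJ, measurable, subst nn_integral_bind_prob[OF q k]) auto
    also have "\<dots> = emeasure m B" using sm B by simp
    finally show "emeasure (distr J borel snd) B = emeasure m B" .
  qed (simp add: sm)
  have c: "integrable J (\<lambda>(x1, x). c x x1)" and w: "integrable m w"
    and eq: "\<And>B. B \<in> sets borel \<Longrightarrow>
      (\<integral>x. indicator B x *\<^sub>R w x \<partial>m) = (\<integral>(x1, x). indicator B x *\<^sub>R c x x1 \<partial>J)"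
    using mv unfolding marginal_velocity_def J_def[symmetric] by (auto simp: Let_def)
  have [measurable]: "w \<in> borel_measurable borel" using borel_measurable_integrable[OF w] by measurable
  have [measurable]: "(\<lambda>z. c (snd z) (fst z)) \<in> borel_measurable (borel \<Otimes>\<^sub>M borel)"
    using borel_measurable_integrable[OF c] by (simp add: split_beta' sJ cong: measurable_cong_sets)
  have c': "integrable J (\<lambda>z. c (snd z) (fst z))" using c by (simp add: split_beta')
  have w': "integrable J (\<lambda>z. w (snd z))" using w unfolding dm[symmetric] by (rule integrable_distr[rotated]) measurable
  have "(\<integral>\<^sup>+z. ennreal (norm (c (snd z) (fst z))) + ennreal (norm (w (snd z))) \<partial>J) < \<infinity>"
    using c' w' by (subst nn_integral_add) (auto simp: integrable_iff_bounded ennreal_add_eq_top less_top)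
  then show ?fin by (subst (asm) nnJ) auto
  assume B [measurable]: "B \<in> sets borel"
  let ?a = "\<lambda>z. indicator B (snd z) * (c (snd z) (fst z) \<bullet> e)" and ?b = "\<lambda>z. indicator B (snd z) * (w (snd z) \<bullet> e)"
  have cB: "integrable J (\<lambda>z. indicat_real B (snd z) *\<^sub>R c (snd z) (fst z))"
    by (rule Bochner_Integration.integrable_bound[OF c']) (auto simp: indicator_def)
  have wB: "integrable J (\<lambda>z. indicat_real B (snd z) *\<^sub>R w (snd z))"
    by (rule Bochner_Integration.integrable_bound[OF w']) (auto simp: indicator_def)
  have "(\<integral>z. indicat_real B (snd z) *\<^sub>R w (snd z) \<partial>J) = (\<integral>z. indicat_real B (snd z) *\<^sub>R c (snd z) (fst z) \<partial>J)"
    using eq[OF B] unfolding dm[symmetric] by (subst (asm) integral_distr) (auto simp: split_beta')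
  then have "(\<integral>z. ?a z \<partial>J) = (\<integral>z. ?b z \<partial>J)"
    using integral_inner_left[OF cB, of e] integral_inner_left[OF wB, of e] by simp
  moreover have "integrable J ?a" "integrable J ?b"
    using integrable_inner_left[OF cB, of e] integrable_inner_left[OF wB, of e] by auto
  ultimately have *: "(\<integral>\<^sup>+z. ennreal (?a z) + ennreal (- ?b z) \<partial>J) = (\<integral>\<^sup>+z. ennreal (- ?a z) + ennreal (?b z) \<partial>J)"
    by (simp add: integral_eq_iff_nn_integral_eq)
  have p: "ennreal (indicator B z * x) = indicator B z * ennreal x"
    "ennreal (- (indicator B z * x)) = indicator B z * ennreal (- x)" for x z
    by (auto simp: indicator_def)
  let ?f = "\<lambda>z. indicator B (snd z) * (ennreal (c (snd z) (fst z) \<bullet> e) + ennreal (- (w (snd z) \<bullet> e)))"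
  let ?g = "\<lambda>z. indicator B (snd z) * (ennreal (- (c (snd z) (fst z) \<bullet> e)) + ennreal (w (snd z) \<bullet> e))"
  have "?f \<in> borel_measurable (borel \<Otimes>\<^sub>M borel)" "?g \<in> borel_measurable (borel \<Otimes>\<^sub>M borel)"
    by measurable
  moreover have "(\<integral>\<^sup>+z. ?f z \<partial>J) = (\<integral>\<^sup>+z. ?g z \<partial>J)"
    using * by (simp only: p distrib_left)
  ultimately show "(\<integral>\<^sup>+x1. \<integral>\<^sup>+x. indicator B x * (ennreal (c x x1 \<bullet> e) + ennreal (- (w x \<bullet> e))) \<partial>k x1 \<partial>q) =
      (\<integral>\<^sup>+x1. \<integral>\<^sup>+x. indicator B x * (ennreal (- (c x x1 \<bullet> e)) + ennreal (w x \<bullet> e)) \<partial>k x1 \<partial>q)"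
    using nnJ[of ?f] nnJ[of ?g] by simp
qed

section \<open>Covariances\<close>

lemma integrable_mult_of_power2:
  fixes f g :: "'w \<Rightarrow> real"
  assumes [measurable]: "f \<in> borel_measurable M" "g \<in> borel_measurable M"
    and "integrable M (\<lambda>\<omega>. (f \<omega>)\<^sup>2)" "integrable M (\<lambda>\<omega>. (g \<omega>)\<^sup>2)"
  shows "integrable M (\<lambda>\<omega>. f \<omega> * g \<omega>)"
proof (rule Bochner_Integration.integrable_bound)
  show "integrable M (\<lambda>\<omega>. (f \<omega>)\<^sup>2 + (g \<omega>)\<^sup>2)" using assms by simp
  have "\<bar>x * y\<bar> \<le> x\<^sup>2 + y\<^sup>2" for x y :: real
    using sum_squares_bound[of "\<bar>x\<bar>" "\<bar>y\<bar>"] abs_ge_zero[of "x * y"] unfolding abs_mult power2_abs by linarith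
  then show "AE \<omega> in M. norm (f \<omega> * g \<omega>) \<le> norm ((f \<omega>)\<^sup>2 + (g \<omega>)\<^sup>2)"
    by (intro AE_I2) simp
qed measurable

text \<open>Pythagoras in L2: \<open>h - H\<close> is orthogonal to every square integrable
  \<open>F\<close>-measurable function. Orthogonality to constants makes the means of
  \<open>Z\<close> and \<open>Y\<close> agree; orthogonality to \<open>Y\<close> removes the cross
  term.\<close>

lemma (in prob_space) variance_residual:
  fixes Y Z h H :: "'a \<Rightarrow> real"
  assumes F: "subalgebra M F"
    and [measurable]: "Z \<in> borel_measurable M" "h \<in> borel_measurable M" "H \<in> borel_measurable M"
    and Y: "Y \<in> borel_measurable F"
    and Z: "\<And>\<omega>. \<omega> \<in> space M \<Longrightarrow> Z \<omega> = Y \<omega> - \<gamma> * (h \<omega> - H \<omega>)"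
    and H: "AE \<omega> in M. real_cond_exp M F h \<omega> = H \<omega>"
    and Z2: "integrable M (\<lambda>\<omega>. (Z \<omega>)\<^sup>2)" and h2: "integrable M (\<lambda>\<omega>. (h \<omega>)\<^sup>2)"
  shows "integrable M (\<lambda>\<omega>. (h \<omega> - H \<omega>)\<^sup>2)"
    and "variance Z = variance Y + \<gamma>\<^sup>2 * (\<integral>\<omega>. (h \<omega> - H \<omega>)\<^sup>2 \<partial>M)"
proof -
  interpret finite_measure_subalgebra M F by unfold_locales fact
  have [measurable]: "Y \<in> borel_measurable M" by (rule measurable_from_subalg[OF F Y])
  have L1: "integrable M f" if "integrable M (\<lambda>\<omega>. (f \<omega>)\<^sup>2)" "f \<in> borel_measurable M" for f :: "'a \<Rightarrow> real"
    using square_integrable_imp_integrable that by blast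
  have h: "integrable M h" by (rule L1) (use h2 in auto)
  \<comment> \<open>Conditional Jensen for the square: conditional expectation does not leave
    L2.\<close>
  have "integrable M (\<lambda>\<omega>. (real_cond_exp M F h \<omega>)\<^sup>2)"
    by (rule integrable_convex_cond_exp[of h UNIV _ _ power2]) (use h h2 in \<open>auto intro: convex_power2\<close>)
  then have H2: "integrable M (\<lambda>\<omega>. (H \<omega>)\<^sup>2)"
    by (rule Bochner_Integration.integrable_cong_AE_imp) (use H in auto)
  have H1: "integrable M H" by (rule L1) (use H2 in auto)
  define d where "d \<omega> = h \<omega> - H \<omega>" for \<omega>
  have [measurable]: "d \<in> borel_measurable M" unfolding d_def by measurable
  have d2: "integrable M (\<lambda>\<omega>. (d \<omega>)\<^sup>2)"
    unfolding d_def power2_diff using h2 H2 integrable_mult_of_power2[OF _ _ h2 H2]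
    by (simp add: mult.assoc)
  then show "integrable M (\<lambda>\<omega>. (h \<omega> - H \<omega>)\<^sup>2)" by (simp add: d_def)
  have d1: "integrable M d" by (rule L1) (use d2 in auto)
  have Zd: "integrable M (\<lambda>\<omega>. Z \<omega> * d \<omega>)" by (rule integrable_mult_of_power2[OF _ _ Z2 d2]) auto
  \<comment> \<open>Square integrability is given for \<open>Z\<close>; it is carried over to
    \<open>Y\<close> through this equation, because orthogonality to \<open>d\<close> requires it of
    \<open>Y\<close>.\<close>
  have Y_eq: "Y \<omega> = Z \<omega> + \<gamma> * d \<omega>" if "\<omega> \<in> space M" for \<omega> using Z[OF that] by (simp add: d_def)
  have "integrable M (\<lambda>\<omega>. (Z \<omega>)\<^sup>2 + \<gamma>\<^sup>2 * (d \<omega>)\<^sup>2 + 2 * \<gamma> * (Z \<omega> * d \<omega>))"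
    using Z2 d2 Zd by simp
  then have Y2: "integrable M (\<lambda>\<omega>. (Y \<omega>)\<^sup>2)"
    by (rule Bochner_Integration.integrable_cong[THEN iffD1, rotated -1]) (auto simp: Y_eq power2_eq_square algebra_simps)
  have Y1: "integrable M Y" by (rule L1) (use Y2 in auto)
  have orth: "(\<integral>\<omega>. f \<omega> * d \<omega> \<partial>M) = 0"
    if f: "f \<in> borel_measurable F" "integrable M (\<lambda>\<omega>. (f \<omega>)\<^sup>2)" for f :: "'a \<Rightarrow> real"
  proof -
    have [measurable]: "f \<in> borel_measurable M" by (rule measurable_from_subalg[OF F f(1)])
    have fh: "integrable M (\<lambda>\<omega>. f \<omega> * h \<omega>)" by (rule integrable_mult_of_power2[OF _ _ f(2) h2]) auto
    have fH: "integrable M (\<lambda>\<omega>. f \<omega> * H \<omega>)" by (rule integrable_mult_of_power2[OF _ _ f(2) H2]) auto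
    have "(\<integral>\<omega>. f \<omega> * H \<omega> \<partial>M) = (\<integral>\<omega>. f \<omega> * real_cond_exp M F h \<omega> \<partial>M)"
      by (rule integral_cong_AE) (use H in auto)
    also have "\<dots> = (\<integral>\<omega>. f \<omega> * h \<omega> \<partial>M)"
      by (rule real_cond_exp_intg(2)[OF fh f(1)]) simp
    finally show ?thesis using fh fH by (simp add: d_def right_diff_distrib)
  qed
  have d0: "(\<integral>\<omega>. d \<omega> \<partial>M) = 0" using orth[of "\<lambda>_. 1"] by simp
  have Yd: "(\<integral>\<omega>. Y \<omega> * d \<omega> \<partial>M) = 0" by (rule orth[OF Y Y2])
  have Yd1: "integrable M (\<lambda>\<omega>. Y \<omega> * d \<omega>)" by (rule integrable_mult_of_power2[OF _ _ Y2 d2]) auto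
  have EZ: "expectation Z = expectation Y"
  proof -
    have "expectation Z = (\<integral>\<omega>. Y \<omega> - \<gamma> * d \<omega> \<partial>M)"
      by (rule Bochner_Integration.integral_cong) (auto simp: Z d_def)
    then show ?thesis using Y1 d1 d0 by simp
  qed
  have "expectation (\<lambda>\<omega>. (Z \<omega>)\<^sup>2) = (\<integral>\<omega>. (Y \<omega>)\<^sup>2 + \<gamma>\<^sup>2 * (d \<omega>)\<^sup>2 - 2 * \<gamma> * (Y \<omega> * d \<omega>) \<partial>M)"
    by (rule Bochner_Integration.integral_cong) (auto simp: Z d_def power2_eq_square algebra_simps)
  also have "\<dots> = expectation (\<lambda>\<omega>. (Y \<omega>)\<^sup>2) + \<gamma>\<^sup>2 * (\<integral>\<omega>. (d \<omega>)\<^sup>2 \<partial>M)"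
    using Y2 d2 Yd1 Yd by simp
  moreover have Z1: "integrable M Z" by (rule L1) (use Z2 in auto)
  ultimately show "variance Z = variance Y + \<gamma>\<^sup>2 * (\<integral>\<omega>. (h \<omega> - H \<omega>)\<^sup>2 \<partial>M)"
    using variance_eq[OF Z1 Z2] variance_eq[OF Y1 Y2] EZ by (simp add: d_def)
qed

lemma trace_cov_matrix: "trace (cov_matrix M Z) = (\<Sum>i\<in>UNIV. prob_space.variance M (\<lambda>\<omega>. Z \<omega> $ i))"
  by (simp add: trace_def cov_matrix_def power2_eq_square)

text \<open>Two \<sigma>-algebras occur: orthogonality needs \<open>F\<close>, for which
  \<open>Y\<close> is measurable, while the covariance is conditioned on \<open>F'\<close>. The
  common conditional expectation \<open>H\<close> reconciles them. The trace sees only diagonal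
  entries, so the scalar identity applies to each component.\<close>

lemma (in prob_space) trace_cov_matrix_residual:
  fixes Y Z h H :: "'a \<Rightarrow> real^'k::finite"
  assumes F: "subalgebra M F" and F': "subalgebra M F'"
    and [measurable]: "Z \<in> borel_measurable M" "h \<in> borel_measurable M" "H \<in> borel_measurable M"
    and Y: "Y \<in> borel_measurable F"
    and Z: "\<And>\<omega>. \<omega> \<in> space M \<Longrightarrow> Z \<omega> = Y \<omega> - \<gamma> *\<^sub>R (h \<omega> - H \<omega>)"
    and H: "\<And>i. AE \<omega> in M. real_cond_exp M F (\<lambda>\<omega>. h \<omega> $ i) \<omega> = H \<omega> $ i"
    and H': "\<And>i. AE \<omega> in M. real_cond_exp M F' (\<lambda>\<omega>. h \<omega> $ i) \<omega> = H \<omega> $ i"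
    and Z2: "integrable M (\<lambda>\<omega>. (norm (Z \<omega>))\<^sup>2)" and h2: "integrable M (\<lambda>\<omega>. (norm (h \<omega>))\<^sup>2)"
  shows "trace (cov_matrix M Z) = trace (cov_matrix M Y)
    + \<gamma>\<^sup>2 * (\<integral>\<omega>. trace (cond_cov_matrix M F' h \<omega>) \<partial>M)"
proof -
  interpret F': finite_measure_subalgebra M F' by unfold_locales fact
  have nth: "integrable M (\<lambda>\<omega>. (f \<omega> $ i)\<^sup>2)"
    if "integrable M (\<lambda>\<omega>. (norm (f \<omega>))\<^sup>2)" and [measurable]: "f \<in> borel_measurable M" for f :: "'a \<Rightarrow> real^'k" and i
  proof (rule Bochner_Integration.integrable_bound[OF that(1)])
    show "AE \<omega> in M. norm ((f \<omega> $ i)\<^sup>2) \<le> norm ((norm (f \<omega>))\<^sup>2)"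
      using component_le_norm_cart[of _ i] by (intro AE_I2) (simp flip: abs_le_square_iff)
  qed measurable
  have meas_nth: "(\<lambda>\<omega>. f \<omega> $ i) \<in> borel_measurable N" if "f \<in> borel_measurable N" for f :: "'a \<Rightarrow> real^'k" and i N
    using that by (rule borel_measurable_vec_nth)
  note * = variance_residual[OF F, of "\<lambda>\<omega>. Z \<omega> $ i" "\<lambda>\<omega>. h \<omega> $ i" "\<lambda>\<omega>. H \<omega> $ i" "\<lambda>\<omega>. Y \<omega> $ i" \<gamma> for i]
  have d2: "integrable M (\<lambda>\<omega>. (h \<omega> $ i - H \<omega> $ i)\<^sup>2)"
    and var: "variance (\<lambda>\<omega>. Z \<omega> $ i) = variance (\<lambda>\<omega>. Y \<omega> $ i) + \<gamma>\<^sup>2 * (\<integral>\<omega>. (h \<omega> $ i - H \<omega> $ i)\<^sup>2 \<partial>M)" for i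
    by (rule *; use H Z in \<open>simp add: nth Z2 h2 meas_nth Y\<close>)+
  \<comment> \<open>The mean of a conditional variance is the mean of the squared residual.
    Integrability is recorded in order to exchange the integral with the sum over the
    diagonal.\<close>
  have cc: "integrable M (real_cond_exp M F' (\<lambda>\<omega>. (h \<omega> $ i - real_cond_exp M F' (\<lambda>\<omega>. h \<omega> $ i) \<omega>)\<^sup>2))"
    "(\<integral>\<omega>. real_cond_exp M F' (\<lambda>\<omega>. (h \<omega> $ i - real_cond_exp M F' (\<lambda>\<omega>. h \<omega> $ i) \<omega>)\<^sup>2) \<omega> \<partial>M)
      = (\<integral>\<omega>. (h \<omega> $ i - H \<omega> $ i)\<^sup>2 \<partial>M)" for i
  proof -
    have ae: "AE \<omega> in M. (h \<omega> $ i - H \<omega> $ i)\<^sup>2 = (h \<omega> $ i - real_cond_exp M F' (\<lambda>\<omega>. h \<omega> $ i) \<omega>)\<^sup>2"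
      using H'[of i] by eventually_elim simp
    have int: "integrable M (\<lambda>\<omega>. (h \<omega> $ i - real_cond_exp M F' (\<lambda>\<omega>. h \<omega> $ i) \<omega>)\<^sup>2)"
      by (rule Bochner_Integration.integrable_cong_AE_imp[OF d2[of i]]) (use ae in auto)
    show "integrable M (real_cond_exp M F' (\<lambda>\<omega>. (h \<omega> $ i - real_cond_exp M F' (\<lambda>\<omega>. h \<omega> $ i) \<omega>)\<^sup>2))"
      by (rule F'.real_cond_exp_int(1)[OF int])
    show "(\<integral>\<omega>. real_cond_exp M F' (\<lambda>\<omega>. (h \<omega> $ i - real_cond_exp M F' (\<lambda>\<omega>. h \<omega> $ i) \<omega>)\<^sup>2) \<omega> \<partial>M)
      = (\<integral>\<omega>. (h \<omega> $ i - H \<omega> $ i)\<^sup>2 \<partial>M)"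
      unfolding F'.real_cond_exp_int(2)[OF int] by (rule integral_cong_AE) (use ae in auto)
  qed
  have "(\<integral>\<omega>. trace (cond_cov_matrix M F' h \<omega>) \<partial>M) = (\<Sum>i\<in>UNIV. \<integral>\<omega>. (h \<omega> $ i - H \<omega> $ i)\<^sup>2 \<partial>M)"
    using cc by (simp add: trace_def cond_cov_matrix_def flip: power2_eq_square)
  then show ?thesis by (simp add: trace_cov_matrix var sum.distrib sum_distrib_left)
qed

lemma cov_matrix_distr:
  fixes Y :: "'z \<Rightarrow> real^'k::finite"
  assumes [measurable]: "\<phi> \<in> M \<rightarrow>\<^sub>M N" "Y \<in> borel_measurable N"
  shows "cov_matrix (distr M N \<phi>) Y = cov_matrix M (\<lambda>\<omega>. Y (\<phi> \<omega>))"
  by (simp add: cov_matrix_def integral_distr)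

section \<open>The sampling laws\<close>

lemma space_uniform_time: "uniform_time \<in> space (prob_algebra time_space)"
proof -
  have "sets uniform_time = sets time_space"
    by (simp add: uniform_time_def time_space_def sets_restrict_space)
  moreover have "prob_space uniform_time"
    by (rule prob_spaceI) (simp add: uniform_time_def emeasure_restrict_space space_restrict_space)
  ultimately show ?thesis by (simp add: space_prob_algebra)
qed

text \<open>The marginal velocity hypothesis covers times before 1, as the fields may be singular at
  the end; this endpoint is negligible for the uniform law.\<close>

lemma AE_uniform_time_less_1: "AE t in uniform_time. t < 1"
  unfolding uniform_time_def
proof (subst AE_restrict_space_iff)
  have "AE t in lborel. t \<noteq> (1::real)" by (rule AE_lborel_singleton)
  then show "AE t in lborel. t \<in> {0..1::real} \<longrightarrow> t < 1" by eventually_elim auto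
qed simp

locale sampling_laws =
  fixes S :: "(real^'d::finite) set" and A :: "'a measure"
    and P :: "real^'d \<Rightarrow> 'a \<Rightarrow> (real^'d) measure" and \<pi> :: "real^'d \<Rightarrow> 'a"
    and \<rho> :: "((real^'d) \<times> 'a) measure"
    and p :: "real \<Rightarrow> real^'d \<Rightarrow> (real^'d) measure"
    and mn :: "real \<Rightarrow> real^'d \<Rightarrow> 'a \<Rightarrow> (real^'d) measure"
  assumes P: "(\<lambda>(s, a). P s a) \<in> state_space S \<Otimes>\<^sub>M A \<rightarrow>\<^sub>M prob_algebra (state_space S)"
    and \<pi> [measurable]: "\<pi> \<in> state_space S \<rightarrow>\<^sub>M A"
    and \<rho>: "\<rho> \<in> space (prob_algebra (state_space S \<Otimes>\<^sub>M A))"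
    and p: "(\<lambda>(t, x1). p t x1) \<in> time_space \<Otimes>\<^sub>M borel \<rightarrow>\<^sub>M prob_algebra borel"
    and mn: "(\<lambda>(t, s, a). mn t s a) \<in> time_space \<Otimes>\<^sub>M state_space S \<Otimes>\<^sub>M A \<rightarrow>\<^sub>M prob_algebra borel"
begin

abbreviation "td2_space \<equiv> time_space \<Otimes>\<^sub>M state_space S \<Otimes>\<^sub>M A \<Otimes>\<^sub>M state_space S
  \<Otimes>\<^sub>M (borel :: (real^'d) measure) \<Otimes>\<^sub>M (borel :: (real^'d) measure)"
abbreviation "td_space \<equiv>
  time_space \<Otimes>\<^sub>M state_space S \<Otimes>\<^sub>M A \<Otimes>\<^sub>M state_space S
  \<Otimes>\<^sub>M (borel :: (real^'d) measure) \<Otimes>\<^sub>M (borel :: (real^'d) measure) \<Otimes>\<^sub>M (borel :: (real^'d) measure)"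
abbreviation "td2 \<equiv> td2_law S A \<rho> P \<pi> p mn"
abbreviation "td \<equiv> td_law S A \<rho> P \<pi> p mn"

text \<open>A successor state plays two roles: argument of the policy and of the kernels on
  \<open>S\<close>, and end point of a conditional path in the whole space. This inclusion passes
  from the first to the second.\<close>

lemma state_borel: "f \<in> Z \<rightarrow>\<^sub>M state_space S \<Longrightarrow> f \<in> Z \<rightarrow>\<^sub>M borel"
  unfolding state_space_def by (rule measurable_restrict_space2_iff[THEN iffD1, THEN conjunct1])

lemma time_1 [simp]: "1 \<in> space time_space"
  by (simp add: time_space_def space_restrict_space)

lemma measurable_P [measurable (raw)]:
  "f \<in> Z \<rightarrow>\<^sub>M state_space S \<Longrightarrow> g \<in> Z \<rightarrow>\<^sub>M A \<Longrightarrow> (\<lambda>z. P (f z) (g z)) \<in> Z \<rightarrow>\<^sub>M prob_algebra (state_space S)"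
  using measurable_compose[OF measurable_Pair P] by simp

lemma measurable_mn [measurable (raw)]:
  "h \<in> Z \<rightarrow>\<^sub>M time_space \<Longrightarrow> f \<in> Z \<rightarrow>\<^sub>M state_space S \<Longrightarrow> g \<in> Z \<rightarrow>\<^sub>M A \<Longrightarrow>
    (\<lambda>z. mn (h z) (f z) (g z)) \<in> Z \<rightarrow>\<^sub>M prob_algebra borel"
  using measurable_compose[OF measurable_Pair[OF _ measurable_Pair] mn] by simp

lemma measurable_p [measurable (raw)]:
  "h \<in> Z \<rightarrow>\<^sub>M time_space \<Longrightarrow> f \<in> Z \<rightarrow>\<^sub>M borel \<Longrightarrow> (\<lambda>z. p (h z) (f z)) \<in> Z \<rightarrow>\<^sub>M prob_algebra borel"
  using measurable_compose[OF measurable_Pair p] by simp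

lemma measurable_p_state [measurable (raw)]:
  "h \<in> Z \<rightarrow>\<^sub>M time_space \<Longrightarrow> f \<in> Z \<rightarrow>\<^sub>M state_space S \<Longrightarrow> (\<lambda>z. p (h z) (f z)) \<in> Z \<rightarrow>\<^sub>M prob_algebra borel"
  by (intro measurable_p state_borel)

lemma space_td2: "td2 \<in> space (prob_algebra td2_space)"
  unfolding td2_law_def
  by (rule space_bind_prob_algebra[OF space_uniform_time measurable_bind_prob_space2[OF measurable_const[OF \<rho>]]])
    measurable

lemma space_td: "td \<in> space (prob_algebra td_space)"
  unfolding td_law_def
  by (rule space_bind_prob_algebra[OF space_uniform_time measurable_bind_prob_space2[OF measurable_const[OF \<rho>]]])
    measurable

lemma space_uniform_timeD: "t \<in> space uniform_time \<Longrightarrow> t \<in> space time_space"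
  using space_uniform_time by (auto simp: space_prob_algebra dest: sets_eq_imp_space_eq)

lemma space_\<rho>D: "(s, a) \<in> space \<rho> \<Longrightarrow> s \<in> space (state_space S) \<and> a \<in> space A"
  using \<rho> by (auto simp: space_prob_algebra space_pair_measure dest!: sets_eq_imp_space_eq)

lemma space_P:
  "s \<in> space (state_space S) \<Longrightarrow> a \<in> space A \<Longrightarrow> P s a \<in> space (prob_algebra (state_space S))"
  using measurable_space[OF P, of "(s, a)"] by (simp add: space_pair_measure)

lemma space_PD:
  "s' \<in> space (P s a) \<Longrightarrow> s \<in> space (state_space S) \<Longrightarrow> a \<in> space A \<Longrightarrow> s' \<in> space (state_space S)"
  using space_P[of s a] by (auto simp: space_prob_algebra dest: sets_eq_imp_space_eq)

lemma space_p: "t \<in> space time_space \<Longrightarrow> p t x \<in> space (prob_algebra borel)"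
  using measurable_space[OF p, of "(t, x)"] by (simp add: space_pair_measure)

lemma space_mn:
  "t \<in> space time_space \<Longrightarrow> s \<in> space (state_space S) \<Longrightarrow> a \<in> space A \<Longrightarrow> mn t s a \<in> space (prob_algebra borel)"
  using measurable_space[OF mn, of "(t, s, a)"] by (simp add: space_pair_measure)

section \<open>The joint laws as iterated integrals\<close>

text \<open>The binds are peeled off from the outside. The kernels are known to be probability
  measures at points of the relevant spaces, so membership of each variable is carried inward before
  the next bind is opened.\<close>

lemma nn_integral_td2:
  assumes f [measurable]: "f \<in> borel_measurable td2_space"
  shows "(\<integral>\<^sup>+\<omega>. f \<omega> \<partial>td2) = (\<integral>\<^sup>+t. \<integral>\<^sup>+(s, a). \<integral>\<^sup>+s'. \<integral>\<^sup>+x. \<integral>\<^sup>+y. f (t, s, a, s', x, y)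
    \<partial>mn t s' (\<pi> s') \<partial>p t s' \<partial>P s a \<partial>\<rho> \<partial>uniform_time)"
  unfolding td2_law_def
proof (subst nn_integral_bind_prob[OF space_uniform_time _ f], goal_cases)
  case 1
  show ?case by (rule measurable_bind_prob_space2[OF measurable_const[OF \<rho>]], measurable)
next
  case 2
  show ?case
  proof (rule nn_integral_cong, drule space_uniform_timeD, subst nn_integral_bind_prob[OF \<rho> _ f], goal_cases)
    case (1 t)
    note [measurable] = 1
    show ?case by measurable
  next
    case t: (2 t)
    \<comment> \<open>As a \<open>[measurable]\<close> fact, membership of \<open>t\<close> makes
      the constant function \<open>t\<close> measurable, which the inner kernels need.\<close>
    note [measurable] = t
    show ?case
    proof (rule nn_integral_cong, clarify, drule space_\<rho>D, elim conjE,
        subst nn_integral_bind_prob[OF space_P _ f], goal_cases)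
      case sa: (4 s a)
      note [measurable] = sa
      have \<pi>': "\<pi> s' \<in> space A" if "s' \<in> space (state_space S)" for s'
        using measurable_space[OF \<pi> that] .
      show ?case
      proof (rule nn_integral_cong, drule space_PD[OF _ sa], subst nn_integral_bind_prob[OF space_p[OF t] _ f], goal_cases)
        case s': (1 s')
        note [measurable] = s'
        show ?case
          by (rule measurable_bind_prob_space2[OF measurable_const[OF space_mn[OF t s' \<pi>'[OF s']]]]) measurable
      next
        case s': (2 s')
        note [measurable] = s'
        show ?case
        proof (rule nn_integral_cong, subst nn_integral_bind_prob[OF space_mn[OF t s' \<pi>'[OF s']] _ f], goal_cases)
          case (2 x)
          show ?case
            by (intro nn_integral_cong, subst nn_integral_return) (use t sa s' in \<open>auto simp: space_pair_measure\<close>)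
        qed measurable
      qed
    qed (measurable)
  qed
qed

lemma nn_integral_td:
  assumes f [measurable]: "f \<in> borel_measurable td_space"
  shows "(\<integral>\<^sup>+\<omega>. f \<omega> \<partial>td) = (\<integral>\<^sup>+t. \<integral>\<^sup>+(s, a). \<integral>\<^sup>+s'. \<integral>\<^sup>+x. \<integral>\<^sup>+x1. \<integral>\<^sup>+y. f (t, s, a, s', x, x1, y)
    \<partial>p t x1 \<partial>mn 1 s' (\<pi> s') \<partial>p t s' \<partial>P s a \<partial>\<rho> \<partial>uniform_time)"
  unfolding td_law_def
proof (subst nn_integral_bind_prob[OF space_uniform_time _ f], goal_cases)
  case 1
  show ?case by (rule measurable_bind_prob_space2[OF measurable_const[OF \<rho>]], measurable)
next
  case 2
  show ?case
  proof (rule nn_integral_cong, drule space_uniform_timeD, subst nn_integral_bind_prob[OF \<rho> _ f], goal_cases)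
    case (1 t)
    note [measurable] = 1
    show ?case by measurable
  next
    case t: (2 t)
    note [measurable] = t
    show ?case
    proof (rule nn_integral_cong, clarify, drule space_\<rho>D, elim conjE,
        subst nn_integral_bind_prob[OF space_P _ f], goal_cases)
      case sa: (4 s a)
      note [measurable] = sa
      have \<pi>': "\<pi> s' \<in> space A" if "s' \<in> space (state_space S)" for s'
        using measurable_space[OF \<pi> that] .
      show ?case
      proof (rule nn_integral_cong, drule space_PD[OF _ sa], subst nn_integral_bind_prob[OF space_p[OF t] _ f], goal_cases)
        case s': (1 s')
        note [measurable] = s'
        show ?case
          by (rule measurable_bind_prob_space2[OF measurable_const[OF space_mn[OF time_1 s' \<pi>'[OF s']]]]) measurable
      next
        case s': (2 s')
        note [measurable] = s'
        show ?case
        proof (rule nn_integral_cong, subst nn_integral_bind_prob[OF space_mn[OF time_1 s' \<pi>'[OF s']] _ f], goal_cases)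
          case (2 x)
          show ?case
          proof (rule nn_integral_cong, subst nn_integral_bind_prob[OF space_p[OF t] _ f], goal_cases)
            case (2 x1)
            show ?case
              by (intro nn_integral_cong, subst nn_integral_return) (use t sa s' in \<open>auto simp: space_pair_measure\<close>)
          qed measurable
        qed measurable
      qed
    qed measurable
  qed
qed

lemma space_state_space: "space (state_space S) = S"
  by (simp add: state_space_def space_restrict_space)

lemma space_time_space: "space time_space = {0..1}"
  by (simp add: time_space_def space_restrict_space)

lemma \<pi>_in: "s \<in> S \<Longrightarrow> \<pi> s \<in> space A"
  using measurable_space[OF \<pi>] by (simp add: space_state_space)

text \<open>Reduces finiteness almost everywhere, the moment bound and the balance identity to the
  two innermost draws, \<open>x1\<close> and \<open>y\<close>, with all other variables fixed.
  Fibres at time 1 are negligible and left out.\<close>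

lemma nn_integral_td_mono:
  assumes f: "f \<in> borel_measurable td_space" and g: "g \<in> borel_measurable td_space"
    and le: "\<And>t s a s' x. t \<in> {0..<1} \<Longrightarrow> s \<in> S \<Longrightarrow> a \<in> space A \<Longrightarrow> s' \<in> S \<Longrightarrow>
      (\<integral>\<^sup>+x1. \<integral>\<^sup>+y. f (t, s, a, s', x, x1, y) \<partial>p t x1 \<partial>mn 1 s' (\<pi> s'))
      \<le> (\<integral>\<^sup>+x1. \<integral>\<^sup>+y. g (t, s, a, s', x, x1, y) \<partial>p t x1 \<partial>mn 1 s' (\<pi> s'))"
  shows "(\<integral>\<^sup>+\<omega>. f \<omega> \<partial>td) \<le> (\<integral>\<^sup>+\<omega>. g \<omega> \<partial>td)"
  unfolding nn_integral_td[OF f] nn_integral_td[OF g]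
proof (rule nn_integral_mono_AE)
  show "AE t in uniform_time. (\<integral>\<^sup>+(s, a). \<integral>\<^sup>+s'. \<integral>\<^sup>+x. \<integral>\<^sup>+x1. \<integral>\<^sup>+y. f (t, s, a, s', x, x1, y)
      \<partial>p t x1 \<partial>mn 1 s' (\<pi> s') \<partial>p t s' \<partial>P s a \<partial>\<rho>)
    \<le> (\<integral>\<^sup>+(s, a). \<integral>\<^sup>+s'. \<integral>\<^sup>+x. \<integral>\<^sup>+x1. \<integral>\<^sup>+y. g (t, s, a, s', x, x1, y)
      \<partial>p t x1 \<partial>mn 1 s' (\<pi> s') \<partial>p t s' \<partial>P s a \<partial>\<rho>)"
    using AE_uniform_time_less_1 AE_space
  proof eventually_elim
    case (elim t)
    then have t: "t \<in> {0..<1}" using space_uniform_timeD by (auto simp: space_time_space)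
    show ?case
    proof (rule nn_integral_mono, clarify)
      fix s a assume "(s, a) \<in> space \<rho>"
      then have sa: "s \<in> space (state_space S)" "a \<in> space A" by (auto dest: space_\<rho>D)
      show "(\<integral>\<^sup>+s'. \<integral>\<^sup>+x. \<integral>\<^sup>+x1. \<integral>\<^sup>+y. f (t, s, a, s', x, x1, y) \<partial>p t x1 \<partial>mn 1 s' (\<pi> s') \<partial>p t s' \<partial>P s a)
        \<le> (\<integral>\<^sup>+s'. \<integral>\<^sup>+x. \<integral>\<^sup>+x1. \<integral>\<^sup>+y. g (t, s, a, s', x, x1, y) \<partial>p t x1 \<partial>mn 1 s' (\<pi> s') \<partial>p t s' \<partial>P s a)"
        by (intro nn_integral_mono le[OF t]) (use sa space_PD[OF _ sa] in \<open>auto simp: space_state_space\<close>)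
    qed
  qed
qed

lemma sets_td: "sets td = sets td_space" and prob_space_td: "prob_space td"
  using space_td by (auto simp: space_prob_algebra)

lemma sets_td2: "sets td2 = sets td2_space" and prob_space_td2: "prob_space td2"
  using space_td2 by (auto simp: space_prob_algebra)

lemma measurable_td2: "f \<in> td2_space \<rightarrow>\<^sub>M N \<Longrightarrow> f \<in> td2 \<rightarrow>\<^sub>M N"
  using sets_td2 by (simp cong: measurable_cong_sets)

lemma measurable_td: "f \<in> td_space \<rightarrow>\<^sub>M N \<Longrightarrow> f \<in> td \<rightarrow>\<^sub>M N"
  using sets_td by (simp cong: measurable_cong_sets)

lemma space_td_iff: "(t, s, a, s', x, x1, y) \<in> space td \<longleftrightarrow> t \<in> {0..1} \<and> s \<in> S \<and> a \<in> space A \<and> s' \<in> S"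
  using sets_eq_imp_space_eq[OF sets_td]
  by (simp add: space_pair_measure space_state_space space_time_space)

lemma space_td2_iff: "(t, s, a, s', x, y) \<in> space td2 \<longleftrightarrow> t \<in> {0..1} \<and> s \<in> S \<and> a \<in> space A \<and> s' \<in> S"
  using sets_eq_imp_space_eq[OF sets_td2]
  by (simp add: space_pair_measure space_state_space space_time_space)

text \<open>Used in two ways: under the mixture assumption it pushes the TD law forward to the TD2
  law, and its preimages form the \<sigma>-algebra that hides \<open>x1\<close>.\<close>

definition "forget_target = (\<lambda>(t::real, s::real^'d, a::'a, s'::real^'d, x::real^'d, x1::real^'d, y::real^'d). (t, s, a, s', x, y))"

lemma forget_target [simp]: "forget_target (t, s, a, s', x, x1, y) = (t, s, a, s', x, y)"
  by (simp add: forget_target_def)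

lemma measurable_forget_target [measurable]: "forget_target \<in> td_space \<rightarrow>\<^sub>M td2_space"
  unfolding forget_target_def by measurable

lemma distr_td_forget_target:
  assumes mix: "\<And>t s a. t \<in> {0..1} \<Longrightarrow> s \<in> S \<Longrightarrow> a \<in> space A \<Longrightarrow> mn t s a = mn 1 s a \<bind> p t"
  shows "distr td td2_space forget_target = td2"
proof (rule measure_eqI)
  show "sets (distr td td2_space forget_target) = sets td2" by (simp add: sets_td2)
  fix B assume "B \<in> sets (distr td td2_space forget_target)"
  then have B [measurable]: "B \<in> sets td2_space" by simp
  have 1: "(\<lambda>\<omega>. indicator B (forget_target \<omega>) :: ennreal) \<in> borel_measurable td_space" by measurable
  have 2: "(\<lambda>\<omega>. indicator B \<omega> :: ennreal) \<in> borel_measurable td2_space" by measurable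
  note [measurable] = measurable_td[OF measurable_forget_target]
  have "emeasure (distr td td2_space forget_target) B = (\<integral>\<^sup>+\<omega>. indicator B (forget_target \<omega>) \<partial>td)"
    by (simp add: nn_integral_distr flip: nn_integral_indicator)
  also have "\<dots> = (\<integral>\<^sup>+\<omega>. indicator B \<omega> \<partial>td2)"
    unfolding nn_integral_td[OF 1] nn_integral_td2[OF 2]
  proof (rule nn_integral_cong)
    fix t assume "t \<in> space uniform_time"
    then have t [measurable]: "t \<in> space time_space" by (rule space_uniform_timeD)
    show "(\<integral>\<^sup>+(s, a). \<integral>\<^sup>+s'. \<integral>\<^sup>+x. \<integral>\<^sup>+x1. \<integral>\<^sup>+y. indicator B (forget_target (t, s, a, s', x, x1, y))
        \<partial>p t x1 \<partial>mn 1 s' (\<pi> s') \<partial>p t s' \<partial>P s a \<partial>\<rho>)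
      = (\<integral>\<^sup>+(s, a). \<integral>\<^sup>+s'. \<integral>\<^sup>+x. \<integral>\<^sup>+y. indicator B (t, s, a, s', x, y)
        \<partial>mn t s' (\<pi> s') \<partial>p t s' \<partial>P s a \<partial>\<rho>)"
    proof (rule nn_integral_cong, clarify)
      fix s a assume "(s, a) \<in> space \<rho>"
      then have sa [measurable]: "s \<in> space (state_space S)" "a \<in> space A" by (auto dest: space_\<rho>D)
      show "(\<integral>\<^sup>+s'. \<integral>\<^sup>+x. \<integral>\<^sup>+x1. \<integral>\<^sup>+y. indicator B (forget_target (t, s, a, s', x, x1, y))
          \<partial>p t x1 \<partial>mn 1 s' (\<pi> s') \<partial>p t s' \<partial>P s a)
        = (\<integral>\<^sup>+s'. \<integral>\<^sup>+x. \<integral>\<^sup>+y. indicator B (t, s, a, s', x, y) \<partial>mn t s' (\<pi> s') \<partial>p t s' \<partial>P s a)"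
      proof (intro nn_integral_cong)
        fix s' x assume "s' \<in> space (P s a)"
        then have s' [measurable]: "s' \<in> space (state_space S)" by (rule space_PD[OF _ sa])
        \<comment> \<open>The indicator does not see \<open>x1\<close>, so the two innermost
          integrals merge into one against \<open>mn 1 s' (\<pi> s') \<bind> p t\<close>.\<close>
        then have "mn t s' (\<pi> s') = mn 1 s' (\<pi> s') \<bind> p t"
          using t by (intro mix) (auto simp: space_state_space space_time_space \<pi>_in)
        then show "(\<integral>\<^sup>+x1. \<integral>\<^sup>+y. indicator B (forget_target (t, s, a, s', x, x1, y)) \<partial>p t x1 \<partial>mn 1 s' (\<pi> s'))
          = (\<integral>\<^sup>+y. indicator B (t, s, a, s', x, y) \<partial>mn t s' (\<pi> s'))"
          using nn_integral_bind_prob[of "mn 1 s' (\<pi> s')" borel "p t" borel "\<lambda>y. indicator B (t, s, a, s', x, y)"]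
            space_mn[OF time_1 s'] \<pi>_in s' by (simp add: space_state_space)
      qed
    qed
  qed
  also have "\<dots> = emeasure td2 B" using B sets_td2 by simp
  finally show "emeasure (distr td td2_space forget_target) B = emeasure td2 B" .
qed

end

section \<open>The gradient estimators\<close>

locale flow_matching = sampling_laws S A P \<pi> \<rho> p mn
  for S :: "(real^'d::finite) set" and A :: "'a measure"
    and P :: "real^'d \<Rightarrow> 'a \<Rightarrow> (real^'d) measure" and \<pi> :: "real^'d \<Rightarrow> 'a"
    and \<rho> :: "((real^'d) \<times> 'a) measure"
    and p :: "real \<Rightarrow> real^'d \<Rightarrow> (real^'d) measure"
    and mn :: "real \<Rightarrow> real^'d \<Rightarrow> 'a \<Rightarrow> (real^'d) measure" +
  fixes \<gamma> :: real
    and v :: "real \<Rightarrow> real^'d \<Rightarrow> real^'d \<Rightarrow> 'a \<Rightarrow> real^'k::finite \<Rightarrow> real^'d"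
    and u :: "real \<Rightarrow> real^'d \<Rightarrow> real^'d \<Rightarrow> real^'d"
    and vn :: "real \<Rightarrow> real^'d \<Rightarrow> real^'d \<Rightarrow> 'a \<Rightarrow> real^'d"
  assumes \<gamma>: "0 \<le> \<gamma>" "\<gamma> < 1"
    and v: "\<And>\<eta>. (\<lambda>(t, x, s, a). v t x s a \<eta>)
          \<in> borel_measurable (time_space \<Otimes>\<^sub>M borel \<Otimes>\<^sub>M state_space S \<Otimes>\<^sub>M A)"
    and v_diff: "\<And>t x s a \<eta>. t \<in> {0..1} \<Longrightarrow> s \<in> S \<Longrightarrow> a \<in> space A \<Longrightarrow>
          (\<lambda>\<eta>. v t x s a \<eta>) differentiable (at \<eta>)"
    and u: "(\<lambda>(t, x, x1). u t x x1) \<in> borel_measurable (time_space \<Otimes>\<^sub>M borel \<Otimes>\<^sub>M borel)"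
    and vn: "(\<lambda>(t, x, s, a). vn t x s a)
          \<in> borel_measurable (time_space \<Otimes>\<^sub>M borel \<Otimes>\<^sub>M state_space S \<Otimes>\<^sub>M A)"
begin

section \<open>Measurability of the fields and of the Jacobian\<close>

lemma measurable_v [measurable (raw)]:
  "h \<in> Z \<rightarrow>\<^sub>M time_space \<Longrightarrow> x \<in> borel_measurable Z \<Longrightarrow> f \<in> Z \<rightarrow>\<^sub>M state_space S \<Longrightarrow> g \<in> Z \<rightarrow>\<^sub>M A \<Longrightarrow>
    (\<lambda>z. v (h z) (x z) (f z) (g z) \<eta>) \<in> borel_measurable Z"
  using measurable_compose[OF measurable_Pair[OF _ measurable_Pair[OF _ measurable_Pair]] v] by simp

lemma measurable_vn [measurable (raw)]:
  "h \<in> Z \<rightarrow>\<^sub>M time_space \<Longrightarrow> x \<in> borel_measurable Z \<Longrightarrow> f \<in> Z \<rightarrow>\<^sub>M state_space S \<Longrightarrow> g \<in> Z \<rightarrow>\<^sub>M A \<Longrightarrow>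
    (\<lambda>z. vn (h z) (x z) (f z) (g z)) \<in> borel_measurable Z"
  using measurable_compose[OF measurable_Pair[OF _ measurable_Pair[OF _ measurable_Pair]] vn] by simp

lemma measurable_u [measurable (raw)]:
  "h \<in> Z \<rightarrow>\<^sub>M time_space \<Longrightarrow> x \<in> borel_measurable Z \<Longrightarrow> f \<in> borel_measurable Z \<Longrightarrow>
    (\<lambda>z. u (h z) (x z) (f z)) \<in> borel_measurable Z"
  using measurable_compose[OF measurable_Pair[OF _ measurable_Pair] u] by simp

lemma measurable_u_state [measurable (raw)]:
  "h \<in> Z \<rightarrow>\<^sub>M time_space \<Longrightarrow> x \<in> borel_measurable Z \<Longrightarrow> f \<in> Z \<rightarrow>\<^sub>M state_space S \<Longrightarrow>
    (\<lambda>z. u (h z) (x z) (f z)) \<in> borel_measurable Z"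
  by (rule measurable_u[OF _ _ state_borel])

text \<open>Differentiability is known at points of the product space, so the limit argument is run
  there and the result composed with the given maps.\<close>

lemma measurable_transpose_jacobian_v [measurable (raw)]:
  assumes "h \<in> Z \<rightarrow>\<^sub>M time_space" "x \<in> borel_measurable Z" "f \<in> Z \<rightarrow>\<^sub>M state_space S" "g \<in> Z \<rightarrow>\<^sub>M A"
  shows "(\<lambda>z. transpose (jacobian (v (h z) (x z) (f z) (g z)) (at \<theta>)) $ i) \<in> borel_measurable Z"
proof -
  have "(\<lambda>\<omega>. transpose (jacobian (\<lambda>\<eta>. case \<omega> of (t, x, s, a) \<Rightarrow> v t x s a \<eta>) (at \<theta>)) $ i)
      \<in> borel_measurable (time_space \<Otimes>\<^sub>M borel \<Otimes>\<^sub>M state_space S \<Otimes>\<^sub>M A)"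
    by (rule borel_measurable_transpose_jacobian)
      (use v_diff in \<open>auto simp: v space_pair_measure space_state_space space_time_space\<close>)
  from measurable_compose[OF measurable_Pair[OF assms(1) measurable_Pair[OF assms(2) measurable_Pair[OF assms(3,4)]]] this]
  show ?thesis by simp
qed

text \<open>Isolates \<open>w\<close> in an inner product with a vector that depends only on the
  Jacobian: the shape \<open>L \<bullet> U\<close> in which the conditional expectation is
  computed.\<close>

lemma vjp_nth: "vjp v \<theta> t x s a w $ i = transpose (jacobian (v t x s a) (at \<theta>)) $ i \<bullet> w"
  by (simp only: vjp_def matrix_vector_mul_component)

lemma vjp_diff: "vjp v \<theta> t x s a (w - w') = vjp v \<theta> t x s a w - vjp v \<theta> t x s a w'"
  by (simp add: vjp_def matrix_vector_mult_diff_distrib)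

lemma measurable_vjp [measurable (raw)]:
  assumes [measurable]: "h \<in> Z \<rightarrow>\<^sub>M time_space" "x \<in> borel_measurable Z" "f \<in> Z \<rightarrow>\<^sub>M state_space S" "g \<in> Z \<rightarrow>\<^sub>M A"
    "w \<in> borel_measurable Z"
  shows "(\<lambda>z. vjp v \<theta> (h z) (x z) (f z) (g z) (w z)) \<in> borel_measurable Z"
  by (rule borel_measurable_vecI) (simp add: vjp_nth)

lemma gderiv_sq_error:
  assumes "t \<in> {0..1}" "s \<in> S" "a \<in> space A"
  shows "GDERIV (\<lambda>\<eta>. (norm (v t x s a \<eta> - c))\<^sup>2) \<eta> :> (2 *\<^sub>R vjp v \<eta> t x s a (v t x s a \<eta> - c))"
  unfolding vjp_def by (rule gderiv_norm_power2[OF v_diff[OF assms]])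

lemma td2_grad_unbiased:
  assumes "integrable td2 (\<lambda>(t, s, a, s', x, y). (norm (v t x s a \<theta> - u t x s'))\<^sup>2)"
    and "integrable td2 (\<lambda>(t, s, a, s', x, y). (norm (v t y s a \<theta> - vn t y s' (\<pi> s')))\<^sup>2)"
    and "locally_dominated td2 (td2_grad \<gamma> v u vn \<pi>) \<theta>"
  shows "integrable td2 (td2_grad \<gamma> v u vn \<pi> \<theta>)"
    and "GDERIV (td2_loss S A \<rho> P \<pi> p mn \<gamma> v u vn) \<theta> :> (2 *\<^sub>R (\<integral>\<omega>. td2_grad \<gamma> v u vn \<pi> \<theta> \<omega> \<partial>td2))"
proof -
  let ?f\<^sub>1 = "\<lambda>\<eta> (t, s, a, s', x, y). (norm (v t x s a \<eta> - u t x s'))\<^sup>2"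
  let ?f\<^sub>2 = "\<lambda>\<eta> (t, s, a, s', x, y). (norm (v t y s a \<eta> - vn t y s' (\<pi> s')))\<^sup>2"
  let ?g\<^sub>1 = "\<lambda>\<eta> (t, s, a, s', x, y). vjp v \<eta> t x s a (v t x s a \<eta> - u t x s')"
  let ?g\<^sub>2 = "\<lambda>\<eta> (t, s, a, s', x, y). vjp v \<eta> t y s a (v t y s a \<eta> - vn t y s' (\<pi> s'))"
  have "?f\<^sub>1 \<eta> \<in> borel_measurable td2" "?f\<^sub>2 \<eta> \<in> borel_measurable td2" for \<eta>
    by (rule measurable_td2, measurable)+
  note * = gderiv_mixture_loss[where g\<^sub>1="?g\<^sub>1" and g\<^sub>2="?g\<^sub>2" and \<theta>=\<theta> and g="td2_grad \<gamma> v u vn \<pi>", OF \<gamma> this]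
  show "integrable td2 (td2_grad \<gamma> v u vn \<pi> \<theta>)"
    by (rule *(1)) (use assms in \<open>auto simp: space_td2_iff td2_grad_def intro!: gderiv_sq_error\<close>)
  show "GDERIV (td2_loss S A \<rho> P \<pi> p mn \<gamma> v u vn) \<theta> :> (2 *\<^sub>R (\<integral>\<omega>. td2_grad \<gamma> v u vn \<pi> \<theta> \<omega> \<partial>td2))"
    unfolding td2_loss_def[abs_def]
    by (rule *(2)) (use assms in \<open>auto simp: space_td2_iff td2_grad_def intro!: gderiv_sq_error\<close>)
qed

lemma td_grad_unbiased:
  assumes "integrable td (\<lambda>(t, s, a, s', x, x1, y). (norm (v t x s a \<theta> - u t x s'))\<^sup>2)"
    and "integrable td (\<lambda>(t, s, a, s', x, x1, y). (norm (v t y s a \<theta> - u t y x1))\<^sup>2)"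
    and "locally_dominated td (td_grad \<gamma> v u) \<theta>"
  shows "integrable td (td_grad \<gamma> v u \<theta>)"
    and "GDERIV (td_loss S A \<rho> P \<pi> p mn \<gamma> v u) \<theta> :> (2 *\<^sub>R (\<integral>\<omega>. td_grad \<gamma> v u \<theta> \<omega> \<partial>td))"
proof -
  let ?f\<^sub>1 = "\<lambda>\<eta> (t, s, a, s', x, x1, y). (norm (v t x s a \<eta> - u t x s'))\<^sup>2"
  let ?f\<^sub>2 = "\<lambda>\<eta> (t, s, a, s', x, x1, y). (norm (v t y s a \<eta> - u t y x1))\<^sup>2"
  let ?g\<^sub>1 = "\<lambda>\<eta> (t, s, a, s', x, x1, y). vjp v \<eta> t x s a (v t x s a \<eta> - u t x s')"
  let ?g\<^sub>2 = "\<lambda>\<eta> (t, s, a, s', x, x1, y). vjp v \<eta> t y s a (v t y s a \<eta> - u t y x1)"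
  have "?f\<^sub>1 \<eta> \<in> borel_measurable td" "?f\<^sub>2 \<eta> \<in> borel_measurable td" for \<eta>
    by (rule measurable_td, measurable)+
  note * = gderiv_mixture_loss[where g\<^sub>1="?g\<^sub>1" and g\<^sub>2="?g\<^sub>2" and \<theta>=\<theta> and g="td_grad \<gamma> v u", OF \<gamma> this]
  show "integrable td (td_grad \<gamma> v u \<theta>)"
    by (rule *(1)) (use assms in \<open>auto simp: space_td_iff td_grad_def intro!: gderiv_sq_error\<close>)
  show "GDERIV (td_loss S A \<rho> P \<pi> p mn \<gamma> v u) \<theta> :> (2 *\<^sub>R (\<integral>\<omega>. td_grad \<gamma> v u \<theta> \<omega> \<partial>td))"
    unfolding td_loss_def[abs_def]
    by (rule *(2)) (use assms in \<open>auto simp: space_td_iff td_grad_def intro!: gderiv_sq_error\<close>)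
qed

section \<open>The residual between the two estimators and its conditional mean\<close>

text \<open>This and the next function are \<open>h\<close> and \<open>H\<close> of the overview.
  \<open>bootstrap_vjp\<close> takes the shorter sample, so that its pullback along
  \<open>forget_target\<close> is measurable for the \<sigma>-algebra hiding
  \<open>x1\<close>.\<close>

definition "target_vjp \<theta> = (\<lambda>(t, s, a, s'::real^'d, x::real^'d, x1, y). vjp v \<theta> t y s a (u t y x1))"
definition "bootstrap_vjp \<theta> = (\<lambda>(t, s, a, s', x::real^'d, y). vjp v \<theta> t y s a (vn t y s' (\<pi> s')))"

text \<open>The terms at \<open>x\<close> and the terms with \<open>v t y s a \<theta>\<close>
  coincide; as the transposed Jacobian acts linearly, only the two velocities at \<open>y\<close>
  remain.\<close>

lemma td_grad_eq:
  "td_grad \<gamma> v u \<theta> \<omega> = td2_grad \<gamma> v u vn \<pi> \<theta> (forget_target \<omega>)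
    - \<gamma> *\<^sub>R (target_vjp \<theta> \<omega> - bootstrap_vjp \<theta> (forget_target \<omega>))"
  by (cases \<omega>) (simp add: td_grad_def td2_grad_def target_vjp_def bootstrap_vjp_def vjp_diff algebra_simps)

text \<open>With \<open>(t, s, a, s', x)\<close> fixed, \<open>x1\<close> and \<open>y\<close>
  follow exactly the joint law in the marginal velocity identity, which says that \<open>V\<close>
  is the mean of \<open>U\<close> given \<open>y\<close>. These fibre identities are assembled into
  one conditional expectation, with the Jacobian row \<open>L\<close> as a factor known from the
  conditioning.\<close>

lemma real_cond_exp_target_vjp:
  assumes mix: "\<And>t s a. t \<in> {0..1} \<Longrightarrow> s \<in> S \<Longrightarrow> a \<in> space A \<Longrightarrow> mn t s a = mn 1 s a \<bind> p t"
    and mv: "\<And>t s a. t \<in> {0..<1} \<Longrightarrow> s \<in> S \<Longrightarrow> a \<in> space A \<Longrightarrow>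
      marginal_velocity (mn 1 s a) (p t) (u t) (mn t s a) (\<lambda>x. vn t x s a)"
    and int: "integrable td (\<lambda>\<omega>. target_vjp \<theta> \<omega> $ i)"
  shows "AE \<omega> in td. real_cond_exp td (vimage_algebra (space td) forget_target td2_space) (\<lambda>\<omega>. target_vjp \<theta> \<omega> $ i) \<omega>
    = bootstrap_vjp \<theta> (forget_target \<omega>) $ i"
proof -
  define U where "U = (\<lambda>(t, s::real^'d, a::'a, s'::real^'d, x::real^'d, x1, y). u t y x1)"
  define V where "V = (\<lambda>(t, s::real^'d, a::'a, s', x::real^'d, y). vn t y s' (\<pi> s'))"
  define L where "L = (\<lambda>(t, s, a, s'::real^'d, x::real^'d, y). transpose (jacobian (v t y s a) (at \<theta>)) $ i)"
  \<comment> \<open>The first moment of both velocities on the fibre over \<open>(t, s')\<close>,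
    finite for \<open>t < 1\<close> but without a uniform bound, hence its use as truncation
    function.\<close>
  define b where "b t s' = (\<integral>\<^sup>+x1. \<integral>\<^sup>+y. ennreal (norm (u t y x1)) + ennreal (norm (vn t y s' (\<pi> s')))
    \<partial>p t x1 \<partial>mn 1 s' (\<pi> s'))" for t s'
  define \<beta> where "\<beta> = (\<lambda>(t, s::real^'d, a::'a, s', x::real^'d, y::real^'d). b t s')"
  have [measurable]: "U \<in> borel_measurable td_space" unfolding U_def by measurable
  have [measurable]: "V \<in> borel_measurable td2_space" unfolding V_def by measurable
  have [measurable]: "L \<in> borel_measurable td2_space" unfolding L_def by measurable
  have [measurable]: "(\<lambda>(t, s'). b t s') \<in> borel_measurable (time_space \<Otimes>\<^sub>M state_space S)"
    unfolding b_def split_beta'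
    by (rule nn_integral_measurable_subprob_algebra2[where N=borel],
        unfold split_beta', rule nn_integral_measurable_subprob_algebra2[where N=borel])
      (measurable, auto intro!: measurable_prob_algebraD)
  have [measurable]: "\<beta> \<in> borel_measurable td2_space" unfolding \<beta>_def by measurable
  have fib: "mn 1 s' (\<pi> s') \<in> space (prob_algebra borel)" "p t \<in> borel \<rightarrow>\<^sub>M prob_algebra borel"
    "mn t s' (\<pi> s') = mn 1 s' (\<pi> s') \<bind> p t"
    "marginal_velocity (mn 1 s' (\<pi> s')) (p t) (u t) (mn t s' (\<pi> s')) (\<lambda>x. vn t x s' (\<pi> s'))"
    if "t \<in> {0..<1}" "s' \<in> S" for t s'
  proof -
    have [measurable]: "t \<in> space time_space" using that by (simp add: space_time_space)
    show "p t \<in> borel \<rightarrow>\<^sub>M prob_algebra borel" by measurable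
  qed (use that in \<open>auto intro!: space_mn mix mv \<pi>_in simp: space_state_space\<close>)
  have b_fin: "b t s' < \<infinity>" if "t \<in> {0..<1}" "s' \<in> S" for t s'
    unfolding b_def using marginal_velocity_balance(1)[OF fib(4,1,2,3)[OF that]] .
  have in_space: "(t, s, a, s', x, y) \<in> space td2_space" if "t \<in> {0..<1}" "s \<in> S" "a \<in> space A" "s' \<in> S" for t s a s' x y
    using that by (auto simp: space_pair_measure space_state_space space_time_space)
  have h_eq: "target_vjp \<theta> \<omega> $ i = L (forget_target \<omega>) \<bullet> U \<omega>" for \<omega>
    by (cases \<omega>) (simp add: L_def U_def target_vjp_def vjp_nth)
  have H_eq: "bootstrap_vjp \<theta> z $ i = L z \<bullet> V z" for z
    by (cases z) (simp add: L_def V_def bootstrap_vjp_def vjp_nth)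
  show ?thesis
    unfolding h_eq H_eq
  proof (rule real_cond_exp_inner[where \<beta>=\<beta>])
    show "prob_space td" by (rule prob_space_td)
    show "forget_target \<in> td \<rightarrow>\<^sub>M td2_space" "U \<in> borel_measurable td" by (rule measurable_td, measurable)+
    show "integrable td (\<lambda>\<omega>. L (forget_target \<omega>) \<bullet> U \<omega>)" using int by (simp add: h_eq)
    \<comment> \<open>The moment is finite on every fibre before time 1, so this indicator
      integrates to 0.\<close>
    let ?I = "\<lambda>\<omega>. indicator {z \<in> space td2_space. \<beta> z = \<infinity>} (forget_target \<omega>) :: ennreal"
    have I: "?I \<in> borel_measurable td_space" by measurable
    have "(\<integral>\<^sup>+\<omega>. ?I \<omega> \<partial>td) \<le> (\<integral>\<^sup>+\<omega>. 0 \<partial>td)"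
      by (rule nn_integral_td_mono[OF I]) (use b_fin in \<open>auto simp: \<beta>_def less_top\<close>)
    then have "AE \<omega> in td. ?I \<omega> = 0"
      using nn_integral_0_iff_AE[OF measurable_td[OF I]] by simp
    then show "AE \<omega> in td. \<beta> (forget_target \<omega>) < \<infinity>"
      using AE_space by eventually_elim
        (use measurable_space[OF measurable_td[OF measurable_forget_target]] in \<open>auto simp: indicator_def less_top split: if_splits\<close>)
  next
    fix n :: nat
    have f: "(\<lambda>\<omega>. indicator {z \<in> space td2_space. \<beta> z \<le> of_nat n} (forget_target \<omega>) *
        (ennreal (norm (U \<omega>)) + ennreal (norm (V (forget_target \<omega>))))) \<in> borel_measurable td_space"
      by measurable
    \<comment> \<open>On each fibre the truncation either keeps everything, and the inner integral
      is \<open>b t s'\<close>, at most \<open>n\<close>, or it removes everything.\<close>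
    have "(\<integral>\<^sup>+\<omega>. indicator {z \<in> space td2_space. \<beta> z \<le> of_nat n} (forget_target \<omega>) *
        (ennreal (norm (U \<omega>)) + ennreal (norm (V (forget_target \<omega>)))) \<partial>td) \<le> (\<integral>\<^sup>+\<omega>. of_nat n \<partial>td)"
    proof (rule nn_integral_td_mono[OF f], measurable)
      fix t s a s' x assume ts: "t \<in> {0..<1::real}" "s \<in> S" "a \<in> space A" "s' \<in> S"
      have "emeasure (mn 1 s' (\<pi> s')) (space (mn 1 s' (\<pi> s'))) = 1" "emeasure (p t x1) (space (p t x1)) = 1" for x1
        using fib(1)[OF ts(1,4)] measurable_space[OF fib(2)[OF ts(1,4)]]
        by (auto simp: space_prob_algebra prob_space.emeasure_space_1)
      moreover have "indicator {z \<in> space td2_space. \<beta> z \<le> of_nat n} (t, s, a, s', x, y) = (if b t s' \<le> of_nat n then 1 else 0 :: ennreal)" for y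
        using in_space[OF ts] by (simp add: indicator_def \<beta>_def)
      ultimately show "(\<integral>\<^sup>+x1. \<integral>\<^sup>+y. indicator {z \<in> space td2_space. \<beta> z \<le> of_nat n} (forget_target (t, s, a, s', x, x1, y)) *
          (ennreal (norm (U (t, s, a, s', x, x1, y))) + ennreal (norm (V (forget_target (t, s, a, s', x, x1, y)))))
          \<partial>p t x1 \<partial>mn 1 s' (\<pi> s')) \<le> (\<integral>\<^sup>+x1. \<integral>\<^sup>+y. of_nat n \<partial>p t x1 \<partial>mn 1 s' (\<pi> s'))"
        by (cases "b t s' \<le> of_nat n") (simp_all add: U_def V_def flip: b_def)
    qed
    also have "\<dots> < \<infinity>"
      using prob_space.emeasure_space_1[OF prob_space_td] by (simp add: of_nat_less_top)
    finally show "(\<integral>\<^sup>+\<omega>. indicator {z \<in> space td2_space. \<beta> z \<le> of_nat n} (forget_target \<omega>) *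
        (ennreal (norm (U \<omega>)) + ennreal (norm (V (forget_target \<omega>)))) \<partial>td) < \<infinity>" .
  next
    fix B and e :: "real^'d" assume B [measurable]: "B \<in> sets td2_space"
    let ?f = "\<lambda>\<omega>. indicator B (forget_target \<omega>) * (ennreal (U \<omega> \<bullet> e) + ennreal (- (V (forget_target \<omega>) \<bullet> e)))"
    let ?g = "\<lambda>\<omega>. indicator B (forget_target \<omega>) * (ennreal (- (U \<omega> \<bullet> e)) + ennreal (V (forget_target \<omega>) \<bullet> e))"
    have meas: "?f \<in> borel_measurable td_space" "?g \<in> borel_measurable td_space" by measurable
    have eq: "(\<integral>\<^sup>+x1. \<integral>\<^sup>+y. ?f (t, s, a, s', x, x1, y) \<partial>p t x1 \<partial>mn 1 s' (\<pi> s'))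
        = (\<integral>\<^sup>+x1. \<integral>\<^sup>+y. ?g (t, s, a, s', x, x1, y) \<partial>p t x1 \<partial>mn 1 s' (\<pi> s'))"
      if ts: "t \<in> {0..<1}" "s \<in> S" "a \<in> space A" "s' \<in> S" for t s a s' x
    proof -
      have "t \<in> space time_space" "s \<in> space (state_space S)" "s' \<in> space (state_space S)"
        using ts by (auto simp: space_state_space space_time_space)
      note [measurable] = this ts(3)
      \<comment> \<open>For fixed \<open>(t, s, a, s', x)\<close> the test set cuts out a Borel set
        of points \<open>y\<close>. Here conditional independence enters: the law of
        \<open>x1\<close> and \<open>y\<close> on the fibre does not involve \<open>x\<close>, so
        \<open>x\<close> affects only this section.\<close>
      define B' where "B' = {y \<in> space borel. (t, s, a, s', x, y) \<in> B}"
      have [measurable]: "B' \<in> sets borel" unfolding B'_def by measurable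
      have "indicator B (t, s, a, s', x, y) = (indicator B' y :: ennreal)" for y
        by (simp add: B'_def indicator_def)
      then show ?thesis
        using marginal_velocity_balance(2)[OF fib(4,1,2,3)[OF ts(1,4)], of B' e] by (simp add: U_def V_def)
    qed
    show "(\<integral>\<^sup>+\<omega>. ?f \<omega> \<partial>td) = (\<integral>\<^sup>+\<omega>. ?g \<omega> \<partial>td)"
      by (intro antisym nn_integral_td_mono meas; simp only: eq order_refl)
  qed measurable
qed

text \<open>Orthogonality to the TD2 estimator requires conditioning on \<open>x\<close> as well,
  the covariance does not condition on it. The tower property bridges the two, since
  \<open>?H\<close> is already measurable for the coarser \<sigma>-algebra.\<close>

lemma trace_cov_td_grad:
  assumes mix: "\<And>t s a. t \<in> {0..1} \<Longrightarrow> s \<in> S \<Longrightarrow> a \<in> space A \<Longrightarrow> mn t s a = mn 1 s a \<bind> p t"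
    and mv: "\<And>t s a. t \<in> {0..<1} \<Longrightarrow> s \<in> S \<Longrightarrow> a \<in> space A \<Longrightarrow>
      marginal_velocity (mn 1 s a) (p t) (u t) (mn t s a) (\<lambda>x. vn t x s a)"
    and int_grad: "integrable td (\<lambda>\<omega>. (norm (td_grad \<gamma> v u \<theta> \<omega>))\<^sup>2)"
    and int_target: "integrable td (\<lambda>\<omega>. (norm (target_vjp \<theta> \<omega>))\<^sup>2)"
  shows "trace (cov_matrix td (td_grad \<gamma> v u \<theta>)) = trace (cov_matrix td2 (td2_grad \<gamma> v u vn \<pi> \<theta>))
      + \<gamma>\<^sup>2 * (\<integral>\<omega>. trace (cond_cov_matrix td (td_observed S A) (target_vjp \<theta>) \<omega>) \<partial>td)"
proof -
  interpret prob_space td by (rule prob_space_td)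
  define obs where "obs = (\<lambda>(t::real, s::real^'d, a::'a, s'::real^'d, x::real^'d, y::real^'d). (t, s, a, s', y))"
  let ?N = "time_space \<Otimes>\<^sub>M state_space S \<Otimes>\<^sub>M A \<Otimes>\<^sub>M state_space S \<Otimes>\<^sub>M (borel :: (real^'d) measure)"
  let ?F = "vimage_algebra (space td) forget_target td2_space"
  let ?h = "target_vjp \<theta>" and ?H = "\<lambda>\<omega>. bootstrap_vjp \<theta> (forget_target \<omega>)"
  have [measurable]: "obs \<in> td2_space \<rightarrow>\<^sub>M ?N" unfolding obs_def by measurable
  have \<phi>: "forget_target \<in> td \<rightarrow>\<^sub>M td2_space" by (rule measurable_td) measurable
  have \<phi>F [measurable]: "forget_target \<in> ?F \<rightarrow>\<^sub>M td2_space"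
    by (rule measurable_vimage_algebra1) (use measurable_space[OF \<phi>] in auto)
  have F: "subalgebra td ?F" by (rule subalgebra_vimage_algebra[OF \<phi>])
  \<comment> \<open>Observation factors through \<open>forget_target\<close>, which places its
    \<sigma>-algebra inside \<open>?F\<close>.\<close>
  have obs_eq: "td_observed S A = vimage_algebra (space ?F) (\<lambda>\<omega>. obs (forget_target \<omega>)) ?N"
    unfolding td_observed_def sets_eq_imp_space_eq[OF sets_td, symmetric]
    by (auto simp: obs_def forget_target_def split_beta' intro!: arg_cong2[where f="\<lambda>X f. vimage_algebra X f ?N"])
  have F'F: "subalgebra ?F (td_observed S A)"
    unfolding obs_eq by (rule subalgebra_vimage_algebra) measurable
  then have F': "subalgebra td (td_observed S A)"
    using F by (auto simp: subalgebra_def)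
  have obsF: "(\<lambda>\<omega>. obs (forget_target \<omega>)) \<in> td_observed S A \<rightarrow>\<^sub>M ?N"
    unfolding obs_eq by (rule measurable_vimage_algebra1) (use measurable_space[of "\<lambda>\<omega>. obs (forget_target \<omega>)" ?F ?N] in auto)
  have [measurable]: "td2_grad \<gamma> v u vn \<pi> \<theta> \<in> borel_measurable td2_space"
    unfolding td2_grad_def by measurable
  have [measurable]: "bootstrap_vjp \<theta> \<in> borel_measurable td2_space"
    unfolding bootstrap_vjp_def by measurable
  have h: "?h \<in> borel_measurable td" unfolding target_vjp_def by (rule measurable_td) measurable
  have Z: "td_grad \<gamma> v u \<theta> \<in> borel_measurable td" unfolding td_grad_def by (rule measurable_td) measurable
  have H: "?H \<in> borel_measurable td" by (rule measurable_td) measurable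
  have Y: "(\<lambda>\<omega>. td2_grad \<gamma> v u vn \<pi> \<theta> (forget_target \<omega>)) \<in> borel_measurable ?F" by measurable
  have int_h: "integrable td (\<lambda>\<omega>. ?h \<omega> $ i)" for i
  proof (rule Bochner_Integration.integrable_bound)
    show "integrable td (\<lambda>\<omega>. norm (?h \<omega>))"
      by (rule square_integrable_imp_integrable) (use h int_target in auto)
    show "AE \<omega> in td. norm (?h \<omega> $ i) \<le> norm (norm (?h \<omega>))"
      by (intro AE_I2) (simp add: component_le_norm_cart)
  qed (use h in measurable)
  have ce: "AE \<omega> in td. real_cond_exp td ?F (\<lambda>\<omega>. ?h \<omega> $ i) \<omega> = ?H \<omega> $ i" for i
    by (rule real_cond_exp_target_vjp[OF mix mv int_h])
  have "AE \<omega> in td. real_cond_exp td (td_observed S A) (\<lambda>\<omega>. ?h \<omega> $ i) \<omega> = ?H \<omega> $ i" for i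
  proof -
    interpret F: finite_measure_subalgebra td ?F by unfold_locales (rule F)
    interpret F': finite_measure_subalgebra td "td_observed S A" by unfold_locales (rule F')
    have Hi: "(\<lambda>\<omega>. ?H \<omega> $ i) \<in> borel_measurable td" using H by measurable
    have int_H: "integrable td (\<lambda>\<omega>. ?H \<omega> $ i)"
      by (rule Bochner_Integration.integrable_cong_AE_imp[OF F.real_cond_exp_int(1)[OF int_h] Hi])
        (use ce[of i] in \<open>auto elim!: AE_mp\<close>)
    \<comment> \<open>Both the Jacobian and the bootstrap velocity are evaluated at
      \<open>(t, s, a, s', y)\<close>, so \<open>?H\<close> factors through the observed
      variables.\<close>
    have "(\<lambda>\<omega>. case obs (forget_target \<omega>) of (t, s, a, s', y) \<Rightarrow> vjp v \<theta> t y s a (vn t y s' (\<pi> s')) $ i)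
        \<in> borel_measurable (td_observed S A)"
      by (rule measurable_compose[OF obsF]) measurable
    then have "(\<lambda>\<omega>. ?H \<omega> $ i) \<in> borel_measurable (td_observed S A)"
      by (simp add: bootstrap_vjp_def obs_def split_beta')
    then have "AE \<omega> in td. real_cond_exp td (td_observed S A) (\<lambda>\<omega>. ?H \<omega> $ i) \<omega> = ?H \<omega> $ i"
      by (rule F'.real_cond_exp_F_meas[OF int_H])
    moreover have "AE \<omega> in td. real_cond_exp td (td_observed S A) (real_cond_exp td ?F (\<lambda>\<omega>. ?h \<omega> $ i)) \<omega>
        = real_cond_exp td (td_observed S A) (\<lambda>\<omega>. ?H \<omega> $ i) \<omega>"
      by (rule F'.real_cond_exp_cong[OF ce]) (use Hi in auto)
    moreover have "AE \<omega> in td. real_cond_exp td (td_observed S A) (real_cond_exp td ?F (\<lambda>\<omega>. ?h \<omega> $ i)) \<omega>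
        = real_cond_exp td (td_observed S A) (\<lambda>\<omega>. ?h \<omega> $ i) \<omega>"
      by (rule F'.real_cond_exp_nested_subalg[OF F F'F int_h])
    ultimately show ?thesis by eventually_elim simp
  qed
  from trace_cov_matrix_residual[OF F F' Z h H Y td_grad_eq ce this int_grad int_target]
  have "trace (cov_matrix td (td_grad \<gamma> v u \<theta>)) =
      trace (cov_matrix td (\<lambda>\<omega>. td2_grad \<gamma> v u vn \<pi> \<theta> (forget_target \<omega>)))
      + \<gamma>\<^sup>2 * (\<integral>\<omega>. trace (cond_cov_matrix td (td_observed S A) ?h \<omega>) \<partial>td)" .
  \<comment> \<open>A covariance depends only on the law of the sample, and the shortened TD sample
    has the TD2 law.\<close>
  moreover have "cov_matrix td (\<lambda>\<omega>. td2_grad \<gamma> v u vn \<pi> \<theta> (forget_target \<omega>)) = cov_matrix td2 (td2_grad \<gamma> v u vn \<pi> \<theta>)"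
    using cov_matrix_distr[OF \<phi>, of "td2_grad \<gamma> v u vn \<pi> \<theta>"] distr_td_forget_target[OF mix] by simp
  ultimately show ?thesis by simp
qed

end

theorem theorem7:
  fixes S :: "(real^'d::finite) set" and A :: "'a measure"
    and P :: "real^'d \<Rightarrow> 'a \<Rightarrow> (real^'d) measure" and \<pi> :: "real^'d \<Rightarrow> 'a"
    and \<rho> :: "((real^'d) \<times> 'a) measure" and \<gamma> :: real
    and m0 :: "(real^'d) measure"
    and v :: "real \<Rightarrow> real^'d \<Rightarrow> real^'d \<Rightarrow> 'a \<Rightarrow> real^'k::finite \<Rightarrow> real^'d"
    and u :: "real \<Rightarrow> real^'d \<Rightarrow> real^'d \<Rightarrow> real^'d"
    and p :: "real \<Rightarrow> real^'d \<Rightarrow> (real^'d) measure"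
    and vn :: "real \<Rightarrow> real^'d \<Rightarrow> real^'d \<Rightarrow> 'a \<Rightarrow> real^'d"
    and mn :: "real \<Rightarrow> real^'d \<Rightarrow> 'a \<Rightarrow> (real^'d) measure"
    and \<theta> :: "real^'k"
  assumes S: "S \<in> sets borel"
    and P: "(\<lambda>(s, a). P s a) \<in> state_space S \<Otimes>\<^sub>M A \<rightarrow>\<^sub>M prob_algebra (state_space S)"
    and \<pi>: "\<pi> \<in> state_space S \<rightarrow>\<^sub>M A"
    and \<rho>: "\<rho> \<in> space (prob_algebra (state_space S \<Otimes>\<^sub>M A))"
    and \<gamma>: "0 \<le> \<gamma>" "\<gamma> < 1"
    and m0: "m0 \<in> space (prob_algebra borel)"
    and v_meas: "\<And>\<eta>. (\<lambda>(t, x, s, a). v t x s a \<eta>)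
          \<in> borel_measurable (time_space \<Otimes>\<^sub>M borel \<Otimes>\<^sub>M state_space S \<Otimes>\<^sub>M A)"
    and v_diff: "\<And>t x s a \<eta>. t \<in> {0..1} \<Longrightarrow> s \<in> S \<Longrightarrow> a \<in> space A \<Longrightarrow>
          (\<lambda>\<eta>. v t x s a \<eta>) differentiable (at \<eta>)"
    and u_meas: "(\<lambda>(t, x, x1). u t x x1) \<in> borel_measurable (time_space \<Otimes>\<^sub>M borel \<Otimes>\<^sub>M borel)"
    and p_meas: "(\<lambda>(t, x1). p t x1) \<in> time_space \<Otimes>\<^sub>M borel \<rightarrow>\<^sub>M prob_algebra borel"
    and p_gen: "\<And>x1. generates m0 (\<lambda>t x. u t x x1) (\<lambda>t. p t x1)"
    and p_0: "\<And>x1. p 0 x1 = m0"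
    and p_1: "\<And>x1. p 1 x1 = return borel x1"
    and vn_meas: "(\<lambda>(t, x, s, a). vn t x s a)
          \<in> borel_measurable (time_space \<Otimes>\<^sub>M borel \<Otimes>\<^sub>M state_space S \<Otimes>\<^sub>M A)"
    and mn_meas: "(\<lambda>(t, s, a). mn t s a)
          \<in> time_space \<Otimes>\<^sub>M state_space S \<Otimes>\<^sub>M A \<rightarrow>\<^sub>M prob_algebra borel"
    and mn_gen: "\<And>s a. s \<in> S \<Longrightarrow> a \<in> space A \<Longrightarrow>
          generates m0 (\<lambda>t x. vn t x s a) (\<lambda>t. mn t s a)"
    and td2_fin1: "integrable (td2_law S A \<rho> P \<pi> p mn)
          (\<lambda>(t, s, a, s', x, y). (norm (v t x s a \<theta> - u t x s'))\<^sup>2)"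
    and td2_fin2: "integrable (td2_law S A \<rho> P \<pi> p mn)
          (\<lambda>(t, s, a, s', x, y). (norm (v t y s a \<theta> - vn t y s' (\<pi> s')))\<^sup>2)"
    and td2_dom: "locally_dominated (td2_law S A \<rho> P \<pi> p mn) (td2_grad \<gamma> v u vn \<pi>) \<theta>"
    and td_fin1: "integrable (td_law S A \<rho> P \<pi> p mn)
          (\<lambda>(t, s, a, s', x, x1, y). (norm (v t x s a \<theta> - u t x s'))\<^sup>2)"
    and td_fin2: "integrable (td_law S A \<rho> P \<pi> p mn)
          (\<lambda>(t, s, a, s', x, x1, y). (norm (v t y s a \<theta> - u t y x1))\<^sup>2)"
    and td_dom: "locally_dominated (td_law S A \<rho> P \<pi> p mn) (td_grad \<gamma> v u) \<theta>"
  shows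
    "(integrable (td2_law S A \<rho> P \<pi> p mn) (td2_grad \<gamma> v u vn \<pi> \<theta>) \<and>
      GDERIV (td2_loss S A \<rho> P \<pi> p mn \<gamma> v u vn) \<theta> :>
        (2 *\<^sub>R (\<integral>\<omega>. td2_grad \<gamma> v u vn \<pi> \<theta> \<omega> \<partial>td2_law S A \<rho> P \<pi> p mn))) \<and>
     (integrable (td_law S A \<rho> P \<pi> p mn) (td_grad \<gamma> v u \<theta>) \<and>
      GDERIV (td_loss S A \<rho> P \<pi> p mn \<gamma> v u) \<theta> :>
        (2 *\<^sub>R (\<integral>\<omega>. td_grad \<gamma> v u \<theta> \<omega> \<partial>td_law S A \<rho> P \<pi> p mn))) \<and>
     ((\<forall>t\<in>{0..1}. \<forall>s\<in>S. \<forall>a\<in>space A. mn t s a = mn 1 s a \<bind> p t) \<and>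
      (\<forall>t\<in>{0..<1}. \<forall>s\<in>S. \<forall>a\<in>space A.
         marginal_velocity (mn 1 s a) (p t) (u t) (mn t s a) (\<lambda>x. vn t x s a)) \<and>
      integrable (td_law S A \<rho> P \<pi> p mn) (\<lambda>\<omega>. (norm (td_grad \<gamma> v u \<theta> \<omega>))\<^sup>2) \<and>
      integrable (td_law S A \<rho> P \<pi> p mn)
        (\<lambda>(t, s, a, s', x, x1, y). (norm (vjp v \<theta> t y s a (u t y x1)))\<^sup>2)
      \<longrightarrow>
      trace (cov_matrix (td_law S A \<rho> P \<pi> p mn) (td_grad \<gamma> v u \<theta>)) =
      trace (cov_matrix (td2_law S A \<rho> P \<pi> p mn) (td2_grad \<gamma> v u vn \<pi> \<theta>))
      + \<gamma>\<^sup>2 * (\<integral>\<omega>. trace (cond_cov_matrix (td_law S A \<rho> P \<pi> p mn) (td_observed S A)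
                    (\<lambda>(t, s, a, s', x, x1, y). vjp v \<theta> t y s a (u t y x1)) \<omega>)
                 \<partial>td_law S A \<rho> P \<pi> p mn))"
proof -
  interpret flow_matching S A P \<pi> \<rho> p mn \<gamma> v u vn
    by unfold_locales fact+
  have target: "(\<lambda>(t, s, a, s', x, x1, y). vjp v \<theta> t y s a (u t y x1)) = target_vjp \<theta>"
    by (simp add: target_vjp_def)
  have norm_target: "(\<lambda>(t, s, a, s', x, x1, y). (norm (vjp v \<theta> t y s a (u t y x1)))\<^sup>2) = (\<lambda>\<omega>. (norm (target_vjp \<theta> \<omega>))\<^sup>2)"
    by (simp add: target_vjp_def split_beta')
  show ?thesis
    unfolding target norm_target
  proof (intro conjI impI)
    show "integrable td2 (td2_grad \<gamma> v u vn \<pi> \<theta>)"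
      "GDERIV (td2_loss S A \<rho> P \<pi> p mn \<gamma> v u vn) \<theta> :> (2 *\<^sub>R (\<integral>\<omega>. td2_grad \<gamma> v u vn \<pi> \<theta> \<omega> \<partial>td2))"
      by (rule td2_grad_unbiased[OF td2_fin1 td2_fin2 td2_dom])+
    show "integrable td (td_grad \<gamma> v u \<theta>)"
      "GDERIV (td_loss S A \<rho> P \<pi> p mn \<gamma> v u) \<theta> :> (2 *\<^sub>R (\<integral>\<omega>. td_grad \<gamma> v u \<theta> \<omega> \<partial>td))"
      by (rule td_grad_unbiased[OF td_fin1 td_fin2 td_dom])+
  qed (elim conjE, rule trace_cov_td_grad, blast+)
qed

end
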